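(* Let $p\in(0,\infty)$ with $p\neq2$, let $\mathfrak N$ be a $\mathrm{II}_1$ factor, and let $\psi$ be a surjective $L^p$-isometry on $\mathscr U(\mathfrak N)$ such that $\psi(I)=I$. Then either $\psi(e^{i\theta}I)=e^{i\theta}I$ for every $\theta\in\mathbb R$, or $\psi(e^{i\theta}I)=e^{-i\theta}I$ for every $\theta\in\mathbb R$.
   Context: $\mathscr U(\mathfrak N)$ is the unitary group of $\mathfrak N$; with $\tau$ the tracial state of $\mathfrak N$, $\|A\|_p:=\tau(|A|^p)^{1/p}$. A map $\psi:\mathscr U(\mathfrak N)\to\mathscr U(\mathfrak N)$ is an $L^p$-isometry if $\|U-V\|_p=\|\psi(U)-\psi(V)\|_p$ for all $U,V\in\mathscr U(\mathfrak N)$. *)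

theory Defs
  imports "HOL-Analysis.Analysis" "HOL-Computational_Algebra.Polynomial"
begin

text \<open>Complex Hilbert spaces. The norm and the topology are those of the underlying real inner
  product space, whose inner product is the real part of the complex one; the latter is linear in
  its first argument.\<close>

class complex_hilbert_space = real_inner + complete_space +
  fixes scaleC :: "complex \<Rightarrow> 'a \<Rightarrow> 'a" (infixr "*\<^sub>C" 75)
    and cinner :: "'a \<Rightarrow> 'a \<Rightarrow> complex"
  assumes scaleC_add_right: "c *\<^sub>C (x + y) = c *\<^sub>C x + c *\<^sub>C y"
    and scaleC_add_left: "(c + d) *\<^sub>C x = c *\<^sub>C x + d *\<^sub>C x"
    and scaleC_scaleC: "c *\<^sub>C (d *\<^sub>C x) = (c * d) *\<^sub>C x"
    and scaleC_of_real: "complex_of_real r *\<^sub>C x = r *\<^sub>R x"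
    and cinner_commute: "cinner x y = cnj (cinner y x)"
    and cinner_add_left: "cinner (x + y) z = cinner x z + cinner y z"
    and cinner_scaleC_left: "cinner (c *\<^sub>C x) y = c * cinner x y"
    and inner_eq_Re_cinner: "inner x y = Re (cinner x y)"

text \<open>The algebra B(H), as a set of bounded real-linear operators.\<close>

definition bounded_ops :: "('h::complex_hilbert_space \<Rightarrow>\<^sub>L 'h) set" where
  "bounded_ops = {A. \<forall>c x. blinfun_apply A (c *\<^sub>C x) = c *\<^sub>C blinfun_apply A x}"

definition scalar_op :: "complex \<Rightarrow> ('h::complex_hilbert_space \<Rightarrow>\<^sub>L 'h)" where
  "scalar_op c = Blinfun (\<lambda>x. c *\<^sub>C x)"

definition adj_op :: "('h::complex_hilbert_space \<Rightarrow>\<^sub>L 'h) \<Rightarrow> ('h \<Rightarrow>\<^sub>L 'h)" where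
  "adj_op A = (THE B. \<forall>x y. cinner (blinfun_apply A x) y = cinner x (blinfun_apply B y))"

definition commutant :: "('h::complex_hilbert_space \<Rightarrow>\<^sub>L 'h) set \<Rightarrow> ('h \<Rightarrow>\<^sub>L 'h) set" where
  "commutant S = {B \<in> bounded_ops. \<forall>A\<in>S. A o\<^sub>L B = B o\<^sub>L A}"

definition von_neumann_algebra :: "('h::complex_hilbert_space \<Rightarrow>\<^sub>L 'h) set \<Rightarrow> bool" where
  "von_neumann_algebra N \<longleftrightarrow>
     N \<subseteq> bounded_ops \<and> (\<forall>A\<in>N. adj_op A \<in> N) \<and> commutant (commutant N) = N"

definition factor :: "('h::complex_hilbert_space \<Rightarrow>\<^sub>L 'h) set \<Rightarrow> bool" where
  "factor N \<longleftrightarrow> von_neumann_algebra N \<and> (id_blinfun :: 'h \<Rightarrow>\<^sub>L 'h) \<noteq> 0 \<and>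
     N \<inter> commutant N = range scalar_op"

definition projections :: "('h::complex_hilbert_space \<Rightarrow>\<^sub>L 'h) set \<Rightarrow> ('h \<Rightarrow>\<^sub>L 'h) set" where
  "projections N = {P \<in> N. P o\<^sub>L P = P \<and> adj_op P = P}"

definition subprojection ::
    "('h::complex_hilbert_space \<Rightarrow>\<^sub>L 'h) \<Rightarrow> ('h \<Rightarrow>\<^sub>L 'h) \<Rightarrow> bool" where
  "subprojection Q P \<longleftrightarrow> P o\<^sub>L Q = Q"

text \<open>Murray-von Neumann equivalence.\<close>

definition equiv_projections ::
    "('h::complex_hilbert_space \<Rightarrow>\<^sub>L 'h) set \<Rightarrow> ('h \<Rightarrow>\<^sub>L 'h) \<Rightarrow> ('h \<Rightarrow>\<^sub>L 'h) \<Rightarrow> bool" where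
  "equiv_projections N P Q \<longleftrightarrow> (\<exists>V\<in>N. adj_op V o\<^sub>L V = P \<and> V o\<^sub>L adj_op V = Q)"

definition finite_projection ::
    "('h::complex_hilbert_space \<Rightarrow>\<^sub>L 'h) set \<Rightarrow> ('h \<Rightarrow>\<^sub>L 'h) \<Rightarrow> bool" where
  "finite_projection N P \<longleftrightarrow> P \<in> projections N \<and>
     (\<forall>Q\<in>projections N. subprojection Q P \<and> equiv_projections N Q P \<longrightarrow> Q = P)"

definition minimal_projection ::
    "('h::complex_hilbert_space \<Rightarrow>\<^sub>L 'h) set \<Rightarrow> ('h \<Rightarrow>\<^sub>L 'h) \<Rightarrow> bool" where
  "minimal_projection N P \<longleftrightarrow> P \<in> projections N \<and> P \<noteq> 0 \<and>
     (\<forall>Q\<in>projections N. subprojection Q P \<longrightarrow> Q = 0 \<or> Q = P)"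

definition type_II1_factor :: "('h::complex_hilbert_space \<Rightarrow>\<^sub>L 'h) set \<Rightarrow> bool" where
  "type_II1_factor N \<longleftrightarrow> factor N \<and> finite_projection N id_blinfun \<and>
     \<not> (\<exists>P. minimal_projection N P)"

text \<open>A type II-1 factor has exactly one tracial state, and that state is faithful.\<close>

definition faithful_tracial_state ::
    "('h::complex_hilbert_space \<Rightarrow>\<^sub>L 'h) set \<Rightarrow> (('h \<Rightarrow>\<^sub>L 'h) \<Rightarrow> complex) \<Rightarrow> bool" where
  "faithful_tracial_state N \<tau> \<longleftrightarrow>
     (\<forall>A\<in>N. \<forall>B\<in>N. \<tau> (A + B) = \<tau> A + \<tau> B) \<and>
     (\<forall>c. \<forall>A\<in>N. \<tau> (scalar_op c o\<^sub>L A) = c * \<tau> A) \<and>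
     (\<forall>A\<in>N. \<tau> (adj_op A o\<^sub>L A) \<in> \<real> \<and> 0 \<le> Re (\<tau> (adj_op A o\<^sub>L A))) \<and>
     \<tau> id_blinfun = 1 \<and>
     (\<forall>A\<in>N. \<forall>B\<in>N. \<tau> (A o\<^sub>L B) = \<tau> (B o\<^sub>L A)) \<and>
     (\<forall>A\<in>N. \<tau> (adj_op A o\<^sub>L A) = 0 \<longrightarrow> A = 0)"

definition spectrum_op :: "('h::complex_hilbert_space \<Rightarrow>\<^sub>L 'h) \<Rightarrow> complex set" where
  "spectrum_op A = {c. \<not> (\<exists>B\<in>bounded_ops.
     B o\<^sub>L (A - scalar_op c) = id_blinfun \<and> (A - scalar_op c) o\<^sub>L B = id_blinfun)}"

definition poly_op :: "real poly \<Rightarrow> ('h::complex_hilbert_space \<Rightarrow>\<^sub>L 'h) \<Rightarrow> ('h \<Rightarrow>\<^sub>L 'h)" where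
  "poly_op q T = (\<Sum>i\<le>degree q. coeff q i *\<^sub>R (((o\<^sub>L) T ^^ i) id_blinfun))"

text \<open>Continuous functional calculus for a self-adjoint operator T and a real function f that is
  continuous on the (real) spectrum of T: the operator f(T) is the norm limit of q(T) as the real
  polynomials q tend to f uniformly on the spectrum.\<close>

definition cfc :: "(real \<Rightarrow> real) \<Rightarrow> ('h::complex_hilbert_space \<Rightarrow>\<^sub>L 'h) \<Rightarrow> ('h \<Rightarrow>\<^sub>L 'h)" where
  "cfc f T = (THE S. \<forall>\<epsilon>>0. \<exists>\<delta>>0. \<forall>q.
     (\<forall>x. complex_of_real x \<in> spectrum_op T \<longrightarrow> \<bar>poly q x - f x\<bar> < \<delta>) \<longrightarrow>
     norm (poly_op q T - S) < \<epsilon>)"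

definition abs_op :: "('h::complex_hilbert_space \<Rightarrow>\<^sub>L 'h) \<Rightarrow> ('h \<Rightarrow>\<^sub>L 'h)" where
  "abs_op A = cfc sqrt (adj_op A o\<^sub>L A)"

definition Lp_norm ::
    "(('h::complex_hilbert_space \<Rightarrow>\<^sub>L 'h) \<Rightarrow> complex) \<Rightarrow> real \<Rightarrow> ('h \<Rightarrow>\<^sub>L 'h) \<Rightarrow> real" where
  "Lp_norm \<tau> p A = Re (\<tau> (cfc (\<lambda>t. t powr p) (abs_op A))) powr (1 / p)"

definition unitary_group :: "('h::complex_hilbert_space \<Rightarrow>\<^sub>L 'h) set \<Rightarrow> ('h \<Rightarrow>\<^sub>L 'h) set" where
  "unitary_group N = {U \<in> N. adj_op U o\<^sub>L U = id_blinfun \<and> U o\<^sub>L adj_op U = id_blinfun}"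

definition Lp_isometry ::
    "('h::complex_hilbert_space \<Rightarrow>\<^sub>L 'h) set \<Rightarrow> (('h \<Rightarrow>\<^sub>L 'h) \<Rightarrow> complex) \<Rightarrow> real \<Rightarrow>
     (('h \<Rightarrow>\<^sub>L 'h) \<Rightarrow> ('h \<Rightarrow>\<^sub>L 'h)) \<Rightarrow> bool" where
  "Lp_isometry N \<tau> p \<psi> \<longleftrightarrow> \<psi> \<in> unitary_group N \<rightarrow> unitary_group N \<and>
     (\<forall>U\<in>unitary_group N. \<forall>V\<in>unitary_group N.
        Lp_norm \<tau> p (U - V) = Lp_norm \<tau> p (\<psi> U - \<psi> V))"

end

theory Submission
  imports Defs "HOL-Computational_Algebra.Fundamental_Theorem_Algebra"
begin

text \<open>For unitaries \<open>U, V\<close> put \<open>T = (U - V)\<^sup>*(U - V)\<close>, so that \<open>(U + V)\<^sup>*(U + V) = 4 - T\<close> and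
  \<open>0 \<le> T \<le> 4\<close>; with \<open>q = p/2\<close> the \<open>p\<close>-th powers of the two distances are \<open>\<tau>(T\<^sup>q)\<close> and \<open>\<tau>((4 - T)\<^sup>q)\<close>.
  Since \<open>q \<noteq> 1\<close> the curve \<open>(x\<^sup>q, (4 - x)\<^sup>q)\<close> is strictly convex or concave, so by faithfulness of the trace
  the two distances determine whether \<open>T\<close> is a given scalar. Points at maximal distance 2 are antipodal, hence
  \<open>\<psi>(-U) = -\<psi>(U)\<close>, and \<open>\<psi>\<close> preserves the relation that \<open>T\<close> is a given scalar. In particular \<open>\<psi>\<close> permutes
  the skew-adjoint unitaries, those at distance \<open>\<surd>2\<close> from both \<open>I\<close> and \<open>-I\<close>. Two of them commute exactly when
  \<open>\<tau>(T\<^sup>q) + \<tau>((4 - T)\<^sup>q) = 4\<^sup>q\<close>, so \<open>\<psi>(iI)\<close> commutes with all of them, is central, and equals \<open>iI\<close> or \<open>-iI\<close>.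
  The distances of \<open>\<psi>(e\<^sup>i\<^sup>\<theta>I)\<close> to the images of \<open>I, -I, iI, -iI\<close> then fix its real and imaginary parts.\<close>

text \<open>The trace yields single numbers, while operator equations are wanted. The passage works
  through positivity: a nonnegative function of T with zero trace vanishes on the spectrum of T. So
  one looks for combinations a x^q + b (4 - x)^q + c that are nonnegative on [0,4] and whose zeros
  carry the information. For q = 1 they are all affine, and the distance to -V is already determined
  by the distance to V; this is why p = 2 is excluded. The commutation test rests on an identity:
  for skew-adjoint unitaries V and W with commutator K, 4 T - T^2 is the adjoint of K times K. So V
  and W commute exactly when the spectrum of T lies in the two end points 0 and 4. Because
  \<open>cfc\<close> is a definite description of a norm limit, nothing can be said about it before
  the norm of q(T) is known to be the maximum of |q| on the spectrum. For real polynomials this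
  follows from their factorisation into linear factors and positive quadratics.\<close>

instance complex_hilbert_space \<subseteq> banach ..

section \<open>Adjoints and invertible operators\<close>

lemma blinfun_eq_iff: "A = B \<longleftrightarrow> (\<forall>x. blinfun_apply A x = blinfun_apply B x)"
  by (auto intro: blinfun_eqI)

lemma Riesz_representation:
  fixes f :: "'a::{real_inner,complete_space} \<Rightarrow> real"
  assumes "bounded_linear f"
  shows "\<exists>y. \<forall>x. f x = inner y x"
proof -
  interpret f: bounded_linear f by fact
  obtain K where K: "\<And>x. norm (f x) \<le> norm x * K" using f.bounded by blast
  \<comment> \<open>The representing vector minimises this functional.\<close>
  define F where "F x = (norm x)\<^sup>2 - 2 * f x" for x
  have lower: "F x \<ge> - K\<^sup>2" for x
  proof -
    have "0 \<le> (norm x - K)\<^sup>2" by simp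
    moreover have "f x \<le> norm x * K" using K[of x] by auto
    ultimately show ?thesis unfolding F_def by (simp add: power2_eq_square algebra_simps)
  qed
  define d where "d = Inf (range F)"
  have bdd: "bdd_below (range F)" using lower unfolding bdd_below_def by blast
  have d: "d \<le> F x" for x unfolding d_def by (rule cInf_lower[OF _ bdd]) auto
  have "\<exists>x. F x < d + 1 / real (Suc n)" for n
    using cInf_lessD[of "range F" "d + 1 / real (Suc n)"] by (auto simp: d_def)
  then obtain X where X: "\<And>n. F (X n) < d + 1 / real (Suc n)" by metis
  \<comment> \<open>Parallelogram identity at the midpoint: two near-minimisers of \<open>F\<close>
    are close to each other, which makes \<open>X\<close> Cauchy.\<close>
  have para: "(norm (x - y))\<^sup>2 \<le> 2 * F x + 2 * F y - 4 * d" for x y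
  proof -
    have "(norm (x - y))\<^sup>2 = 2 * F x + 2 * F y - 4 * F ((1/2) *\<^sub>R (x + y))"
      unfolding F_def by (simp add: f.scaleR f.add power2_norm_eq_inner inner_simps inner_commute algebra_simps)
    then show ?thesis using d[of "(1/2) *\<^sub>R (x + y)"] by linarith
  qed
  have "Cauchy X"
  proof (rule metric_CauchyI)
    fix e :: real assume e: "e > 0"
    obtain M where M: "1 / real (Suc M) < e\<^sup>2 / 4"
      using reals_Archimedean[of "e\<^sup>2 / 4"] e by (auto simp: inverse_eq_divide)
    have "dist (X m) (X n) < e" if "m \<ge> M" "n \<ge> M" for m n
    proof -
      have "1 / real (Suc m) \<le> 1 / real (Suc M)" "1 / real (Suc n) \<le> 1 / real (Suc M)"
        using that by (auto simp: field_simps)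
      then have "(norm (X m - X n))\<^sup>2 < e\<^sup>2"
        using para[of "X m" "X n"] X[of m] X[of n] M by linarith
      then show ?thesis using e by (simp add: dist_norm power2_less_imp_less)
    qed
    then show "\<exists>M. \<forall>m\<ge>M. \<forall>n\<ge>M. dist (X m) (X n) < e" by blast
  qed
  then obtain y where y: "X \<longlonglongrightarrow> y" using Cauchy_convergent convergent_def by blast
  have "(\<lambda>n. F (X n)) \<longlonglongrightarrow> F y"
    unfolding F_def by (intro tendsto_intros y f.tendsto)
  moreover have "(\<lambda>n. d + 1 / real (Suc n)) \<longlonglongrightarrow> d + 0"
    by (intro tendsto_intros LIMSEQ_Suc lim_1_over_n)
  ultimately have "F y \<le> d + 0"
    by (rule LIMSEQ_le) (use X in \<open>auto intro: less_imp_le\<close>)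
  then have min: "F y \<le> F x" for x using d[of x] by linarith
  have "f z = inner y z" for z
  proof (cases "z = 0")
    case False
    define a where "a = inner y z - f z"
    have n: "norm z > 0" using False by simp
    \<comment> \<open>This \<open>t\<close> minimises the quadratic t -> F (y + t z); a nonzero
      \<open>a\<close> would push the value below the minimum \<open>F y\<close>.\<close>
    define t where "t = - a / (norm z)\<^sup>2"
    have "F (y + t *\<^sub>R z) = F y + 2 * t * a + t\<^sup>2 * (norm z)\<^sup>2"
      unfolding F_def a_def power2_norm_eq_inner
      by (simp add: f.scaleR f.add inner_simps inner_commute power2_eq_square algebra_simps)
    then have "0 \<le> 2 * t * a + t\<^sup>2 * (norm z)\<^sup>2" using min[of "y + t *\<^sub>R z"] by linarith
    also have "\<dots> = - (a\<^sup>2 / (norm z)\<^sup>2)"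
      using n unfolding t_def by (simp add: field_simps power2_eq_square)
    finally have "a\<^sup>2 / (norm z)\<^sup>2 \<le> 0" by simp
    then have "a = 0" using n by (simp add: divide_le_0_iff)
    then show ?thesis by (simp add: a_def)
  qed (simp add: f.zero)
  then show ?thesis by blast
qed

lemma cinner_scaleC_right:
  "cinner x (c *\<^sub>C y) = cnj c * cinner (x::'h::complex_hilbert_space) y"
  using cinner_commute[of x "c *\<^sub>C y"] cinner_commute[of x y] by (simp add: cinner_scaleC_left)

lemma norm_scaleC: "norm (c *\<^sub>C (x::'h::complex_hilbert_space)) = cmod c * norm x"
proof -
  have r: "cinner x x \<in> \<real>"
    using cinner_commute[of x x] by (metis Reals_cnj_iff)
  have "(norm (c *\<^sub>C x))\<^sup>2 = Re (c * cnj c * cinner x x)"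
    by (simp add: power2_norm_eq_inner inner_eq_Re_cinner cinner_scaleC_left cinner_scaleC_right mult_ac)
  also have "\<dots> = (cmod c)\<^sup>2 * Re (cinner x x)"
    by (simp add: complex_norm_square[symmetric] del: of_real_power)
  also have "\<dots> = (cmod c * norm x)\<^sup>2"
    by (simp add: power2_norm_eq_inner inner_eq_Re_cinner power_mult_distrib)
  finally show ?thesis by (simp add: power2_eq_iff_nonneg)
qed

lemma bounded_linear_scaleC: "bounded_linear (\<lambda>x::'h::complex_hilbert_space. c *\<^sub>C x)"
proof (rule bounded_linear_intro[where K="cmod c"])
  fix r and x :: 'h
  show "c *\<^sub>C (r *\<^sub>R x) = r *\<^sub>R (c *\<^sub>C x)"
    by (metis mult.commute scaleC_of_real scaleC_scaleC)
qed (simp_all add: scaleC_add_right norm_scaleC mult.commute)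

lemma scalar_op_apply [simp]: "blinfun_apply (scalar_op c) x = c *\<^sub>C x"
  unfolding scalar_op_def by (simp add: bounded_linear_Blinfun_apply[OF bounded_linear_scaleC])

lemmas scaleC_linear = linear_simps[OF bounded_linear_scaleC]

lemma scaleC_minus_left: "(- c) *\<^sub>C (x::'h::complex_hilbert_space) = - (c *\<^sub>C x)"
  using scaleC_add_left[of "-c" c x] scaleC_of_real[of 0 x] by (simp add: eq_neg_iff_add_eq_0)

lemma scaleC_one [simp]: "1 *\<^sub>C (x::'h::complex_hilbert_space) = x"
  using scaleC_of_real[of 1 x] by simp

lemma scalar_op_of_real: "scalar_op (of_real r) = r *\<^sub>R id_blinfun"
  by (rule blinfun_eqI) (simp add: scaleC_of_real blinfun.scaleR_left)

lemma scalar_op_in_bounded_ops: "scalar_op c \<in> bounded_ops"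
  by (simp add: bounded_ops_def scaleC_scaleC mult.commute)

text \<open>Imaginary parts are real inner products at a rotated vector. For complex linear
  operators, real adjoint identities therefore imply complex ones.\<close>

lemma Im_cinner: "Im (cinner x y) = inner ((-\<i>) *\<^sub>C x) (y::'h::complex_hilbert_space)"
  by (simp add: inner_eq_Re_cinner cinner_scaleC_left)

lemma inner_eqI:
  fixes a b :: "'a::real_inner"
  assumes "\<And>x. inner x a = inner x b"
  shows "a = b"
  using assms[of "a - b"] by (metis eq_iff_diff_eq_0 inner_diff_right inner_eq_zero_iff)

text \<open>Riesz representation gives an adjoint for the real inner product. Its identity at
  \<open>(-\<i>) *\<^sub>C x\<close> settles the imaginary parts, because \<open>A\<close> is
  complex linear.\<close>

lemma adj_op_exists:
  assumes "A \<in> bounded_ops"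
  shows "\<exists>B. \<forall>x y. cinner (blinfun_apply A x) y = cinner x (blinfun_apply B y)"
proof -
  have "\<forall>y. \<exists>z. \<forall>x. inner (blinfun_apply A x) y = inner z x"
    by (intro allI Riesz_representation bounded_linear_compose[OF bounded_linear_inner_left] 
          blinfun.bounded_linear_right)
  then obtain B where B: "\<And>x y. inner (blinfun_apply A x) y = inner x (B y)"
    by (metis inner_commute)
  have "bounded_linear B"
  proof (rule bounded_linear_intro[where K="norm A"])
    show "B (x + y) = B x + B y" for x y
      by (rule inner_eqI) (simp add: B[symmetric] inner_add_right)
    show "B (r *\<^sub>R x) = r *\<^sub>R B x" for r x
      by (rule inner_eqI) (simp add: B[symmetric])
    show "norm (B x) \<le> norm x * norm A" for x
    proof -
      have "norm (B x) * norm (B x) = inner (blinfun_apply A (B x)) x"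
        by (metis B power2_eq_square power2_norm_eq_inner)
      also have "\<dots> \<le> (norm A * norm (B x)) * norm x"
        using norm_blinfun[of A "B x"] norm_cauchy_schwarz[of "blinfun_apply A (B x)" x]
        by (meson mult_right_mono norm_ge_zero order_trans)
      finally have "norm (B x) * norm (B x) \<le> norm (B x) * (norm x * norm A)" by (simp add: mult_ac)
      then show ?thesis
        by (cases "norm (B x) = 0") (auto simp: mult_le_cancel_left)
    qed
  qed
  then have app: "blinfun_apply (Blinfun B) = B" by (simp add: bounded_linear_Blinfun_apply)
  have "cinner (blinfun_apply A x) y = cinner x (B y)" for x y
  proof (rule complex_eqI)
    show "Re (cinner (blinfun_apply A x) y) = Re (cinner x (B y))"
      using B[of x y] by (simp add: inner_eq_Re_cinner)
    show "Im (cinner (blinfun_apply A x) y) = Im (cinner x (B y))"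
      using B[of "(-\<i>) *\<^sub>C x" y] assms by (simp add: Im_cinner bounded_ops_def)
  qed
  then show ?thesis using app by (intro exI[of _ "Blinfun B"]) simp
qed

lemma adj_op_eqI:
  assumes "\<And>x y. cinner (blinfun_apply A x) y = cinner x (blinfun_apply B y)"
  shows "adj_op A = B"
  unfolding adj_op_def
proof (rule the_equality)
  fix C assume C: "\<forall>x y. cinner (blinfun_apply A x) y = cinner x (blinfun_apply C y)"
  show "C = B"
    by (rule blinfun_eqI, rule inner_eqI) (simp add: inner_eq_Re_cinner C[rule_format, symmetric] assms)
qed (use assms in blast)

lemma cinner_adj_op:
  assumes "A \<in> bounded_ops"
  shows "cinner (blinfun_apply A x) y = cinner x (blinfun_apply (adj_op A) y)"
proof -
  obtain B where B: "\<And>x y. cinner (blinfun_apply A x) y = cinner x (blinfun_apply B y)"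
    using adj_op_exists[OF assms] by blast
  then have "adj_op A = B" by (rule adj_op_eqI)
  then show ?thesis using B by simp
qed

lemma inner_adj_op:
  assumes "A \<in> bounded_ops"
  shows "inner (blinfun_apply A x) y = inner x (blinfun_apply (adj_op A) y)"
  by (simp add: cinner_adj_op[OF assms] inner_eq_Re_cinner)

lemma cinner_adj_op':
  assumes "A \<in> bounded_ops"
  shows "cinner (blinfun_apply (adj_op A) x) y = cinner x (blinfun_apply A y)"
  using cinner_adj_op[OF assms, of y x] cinner_commute[of "blinfun_apply A y" x]
    cinner_commute[of "blinfun_apply (adj_op A) x" y] by (metis complex_cnj_cnj)

lemma cinner_add_right: "cinner (x::'h::complex_hilbert_space) (y + z) = cinner x y + cinner x z"
  using cinner_commute[of x "y + z"] cinner_commute[of x y] cinner_commute[of x z]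
  by (simp add: cinner_add_left)

lemma cinner_scaleR:
  "cinner (r *\<^sub>R x) y = r * cinner x (y::'h::complex_hilbert_space)"
  "cinner x (r *\<^sub>R y) = r * cinner x (y::'h::complex_hilbert_space)"
  by (simp_all add: scaleC_of_real[symmetric] cinner_scaleC_left cinner_scaleC_right)

lemma cinner_minus:
  "cinner (- x) y = - cinner x (y::'h::complex_hilbert_space)"
  "cinner x (- y) = - cinner x (y::'h::complex_hilbert_space)"
  using cinner_scaleR(1)[of "-1" x y] cinner_scaleR(2)[of x "-1" y] by simp_all

lemma cinner_diff:
  "cinner (x - z) y = cinner x y - cinner z (y::'h::complex_hilbert_space)"
  "cinner x (y - z) = cinner x y - cinner x (z::'h::complex_hilbert_space)"
  using cinner_add_left[of x "-z" y] cinner_add_right[of x y "-z"] by (simp_all add: cinner_minus)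

lemma adj_op_add: "A \<in> bounded_ops \<Longrightarrow> B \<in> bounded_ops \<Longrightarrow> adj_op (A + B) = adj_op A + adj_op B"
  by (rule adj_op_eqI) (simp add: blinfun.bilinear_simps cinner_add_left cinner_add_right cinner_adj_op)

lemma adj_op_diff: "A \<in> bounded_ops \<Longrightarrow> B \<in> bounded_ops \<Longrightarrow> adj_op (A - B) = adj_op A - adj_op B"
  by (rule adj_op_eqI) (simp add: blinfun.bilinear_simps cinner_diff cinner_adj_op)

lemma adj_op_minus: "A \<in> bounded_ops \<Longrightarrow> adj_op (- A) = - adj_op A"
  by (rule adj_op_eqI) (simp add: blinfun.bilinear_simps cinner_minus cinner_adj_op)

lemma adj_op_compose: "A \<in> bounded_ops \<Longrightarrow> B \<in> bounded_ops \<Longrightarrow> adj_op (A o\<^sub>L B) = adj_op B o\<^sub>L adj_op A"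
  by (rule adj_op_eqI) (simp add: cinner_adj_op)

lemma adj_op_adj_op: "A \<in> bounded_ops \<Longrightarrow> adj_op (adj_op A) = A"
  by (rule adj_op_eqI) (simp add: cinner_adj_op')

lemma adj_op_scalar_op: "adj_op (scalar_op c) = scalar_op (cnj c)"
  by (rule adj_op_eqI) (simp add: cinner_scaleC_left cinner_scaleC_right)

lemma adj_op_id: "adj_op id_blinfun = id_blinfun"
  by (rule adj_op_eqI) simp

lemma bounded_ops_intros:
  "id_blinfun \<in> bounded_ops"
  "0 \<in> bounded_ops"
  "A \<in> bounded_ops \<Longrightarrow> B \<in> bounded_ops \<Longrightarrow> A + B \<in> bounded_ops"
  "A \<in> bounded_ops \<Longrightarrow> B \<in> bounded_ops \<Longrightarrow> A - B \<in> bounded_ops"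
  "A \<in> bounded_ops \<Longrightarrow> - A \<in> bounded_ops"
  "A \<in> bounded_ops \<Longrightarrow> r *\<^sub>R A \<in> bounded_ops"
  "A \<in> bounded_ops \<Longrightarrow> B \<in> bounded_ops \<Longrightarrow> A o\<^sub>L B \<in> bounded_ops"
  by (simp_all add: bounded_ops_def blinfun.add_left blinfun.diff_left blinfun.minus_left
      blinfun.scaleR_left scaleC_linear)

text \<open>The inverse has to be complex linear, so that failure for \<open>T - x\<close> is
  literally the clause in \<open>spectrum_op\<close>.\<close>

definition invertible_op :: "('h::complex_hilbert_space \<Rightarrow>\<^sub>L 'h) \<Rightarrow> bool" where
  "invertible_op B \<longleftrightarrow> (\<exists>C\<in>bounded_ops. C o\<^sub>L B = id_blinfun \<and> B o\<^sub>L C = id_blinfun)"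

text \<open>A Lax--Milgram lemma: for small t the map x - t (B x - y) is a contraction.\<close>

lemma coercive_invertible:
  fixes B :: "'h::complex_hilbert_space \<Rightarrow>\<^sub>L 'h"
  assumes B: "B \<in> bounded_ops" and c: "c > 0"
    and coercive: "\<And>x. inner (blinfun_apply B x) x \<ge> c * (norm x)\<^sup>2"
  shows "invertible_op B"
proof -
  \<comment> \<open>The summand \<open>c\<close> keeps \<open>M\<close> positive and at least
    \<open>c\<close> even on the zero space; this gives \<open>t * c \<le> 1\<close> below.\<close>
  define M where "M = norm B + c"
  have M: "M > 0" "norm B \<le> M" "c \<le> M" unfolding M_def using c norm_ge_zero[of B] by linarith+
  \<comment> \<open>Minimiser of 1 - 2 t c + t^2 M^2, which bounds the squared contraction factor;
    the minimum is 1 - t c, the square of \<open>k\<close>.\<close>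
  define t where "t = c / M\<^sup>2"
  have t: "t > 0" using c M by (simp add: t_def)
  define k where "k = sqrt (1 - t * c)"
  have "c * c \<le> M\<^sup>2"
    using M c by (simp add: power2_eq_square mult_mono)
  then have tc: "t * c \<le> 1"
    using M by (simp add: t_def)
  have "0 < t * c" using t c by simp
  then have k: "0 \<le> k" "k < 1" using tc by (auto simp: k_def)
  have contr: "norm (x - t *\<^sub>R blinfun_apply B x) \<le> k * norm x" for x
  proof -
    have "(norm (x - t *\<^sub>R blinfun_apply B x))\<^sup>2
        = (norm x)\<^sup>2 - 2 * t * inner (blinfun_apply B x) x + t\<^sup>2 * (norm (blinfun_apply B x))\<^sup>2"
      unfolding power2_norm_eq_inner
      by (simp add: inner_simps inner_commute power2_eq_square algebra_simps)
    also have "\<dots> \<le> (norm x)\<^sup>2 - 2 * t * (c * (norm x)\<^sup>2) + t\<^sup>2 * (M * norm x)\<^sup>2"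
    proof -
      have "norm (blinfun_apply B x) \<le> M * norm x"
        using norm_blinfun[of B x] M by (meson mult_right_mono norm_ge_zero order_trans)
      then have "(norm (blinfun_apply B x))\<^sup>2 \<le> (M * norm x)\<^sup>2" by (simp add: power_mono)
      then have "t\<^sup>2 * (norm (blinfun_apply B x))\<^sup>2 \<le> t\<^sup>2 * (M * norm x)\<^sup>2" by (simp add: mult_left_mono)
      moreover have "2 * t * (c * (norm x)\<^sup>2) \<le> 2 * t * inner (blinfun_apply B x) x"
        using coercive[of x] t by simp
      ultimately show ?thesis by linarith
    qed
    also have "t\<^sup>2 * (M * norm x)\<^sup>2 = t * c * (norm x)\<^sup>2"
      using M by (simp add: t_def power2_eq_square)
    also have "(norm x)\<^sup>2 - 2 * t * (c * (norm x)\<^sup>2) + t * c * (norm x)\<^sup>2 = (k * norm x)\<^sup>2"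
      using tc by (simp add: k_def power_mult_distrib algebra_simps)
    finally show ?thesis using k by (auto intro: power2_le_imp_le)
  qed
  have below: "c * norm x \<le> norm (blinfun_apply B x)" for x
  proof -
    have "c * norm x * norm x \<le> norm (blinfun_apply B x) * norm x"
      using coercive[of x] norm_cauchy_schwarz[of "blinfun_apply B x" x]
      by (simp add: power2_eq_square)
    then show ?thesis by (cases "x = 0") auto
  qed
  have inj: "x = y" if "blinfun_apply B x = blinfun_apply B y" for x y
  proof -
    have "c * norm (x - y) \<le> 0" using below[of "x - y"] that by (simp add: blinfun.bilinear_simps)
    then show ?thesis using c by (simp add: mult_le_0_iff)
  qed
  have "\<exists>x. blinfun_apply B x = y" for y
  proof -
    define g where "g x = x - t *\<^sub>R blinfun_apply B x + t *\<^sub>R y" for x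
    have "\<exists>!x. g x = x"
    proof (rule banach_fix_type[OF k])
      show "\<forall>x z. dist (g x) (g z) \<le> k * dist x z"
      proof (intro allI)
        fix x z
        have "g x - g z = (x - z) - t *\<^sub>R blinfun_apply B (x - z)"
          by (simp add: g_def blinfun.bilinear_simps algebra_simps)
        then show "dist (g x) (g z) \<le> k * dist x z" using contr[of "x - z"] by (simp add: dist_norm)
      qed
    qed
    then obtain x where "g x = x" by blast
    then have "t *\<^sub>R blinfun_apply B x = t *\<^sub>R y" by (auto simp: g_def)
    then have "blinfun_apply B x = y" using t by simp
    then show ?thesis by blast
  qed
  then obtain G where G: "\<And>y. blinfun_apply B (G y) = y" by metis
  have "bounded_linear G"
  proof (rule bounded_linear_intro[where K="1 / c"])
    show "G (x + y) = G x + G y" for x y by (rule inj) (simp add: G blinfun.bilinear_simps)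
    show "G (r *\<^sub>R x) = r *\<^sub>R G x" for r x by (rule inj) (simp add: G blinfun.bilinear_simps)
    show "norm (G x) \<le> norm x * (1 / c)" for x
      using below[of "G x"] c by (simp add: G field_simps)
  qed
  then have app: "blinfun_apply (Blinfun G) = G" by (simp add: bounded_linear_Blinfun_apply)
  have "G (d *\<^sub>C x) = d *\<^sub>C G x" for d x
    by (rule inj) (use B in \<open>simp add: G bounded_ops_def\<close>)
  then have "Blinfun G \<in> bounded_ops" by (simp add: bounded_ops_def app)
  moreover have "Blinfun G o\<^sub>L B = id_blinfun"
    by (intro blinfun_eqI) (simp add: app, rule inj, simp add: G)
  moreover have "B o\<^sub>L Blinfun G = id_blinfun"
    by (intro blinfun_eqI) (simp add: app G)
  ultimately show ?thesis unfolding invertible_op_def by blast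
qed

section \<open>Polynomials of self-adjoint operators\<close>

text \<open>Stated with the real inner product, since the spectral estimates use real quadratic
  forms; for complex linear operators it is the usual self-adjointness.\<close>

definition symmetric_op :: "('h::complex_hilbert_space \<Rightarrow>\<^sub>L 'h) \<Rightarrow> bool" where
  "symmetric_op T \<longleftrightarrow> T \<in> bounded_ops \<and>
     (\<forall>x y. inner (blinfun_apply T x) y = inner x (blinfun_apply T y))"

lemma symmetric_opD:
  assumes "symmetric_op T"
  shows "T \<in> bounded_ops" "inner (blinfun_apply T x) y = inner x (blinfun_apply T y)"
  using assms by (auto simp: symmetric_op_def)

lemma symmetric_op_iff_adj: "symmetric_op T \<longleftrightarrow> T \<in> bounded_ops \<and> adj_op T = T"
proof
  assume T: "symmetric_op T"
  have "cinner (blinfun_apply T x) y = cinner x (blinfun_apply T y)" for x y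
  proof (rule complex_eqI)
    show "Re (cinner (blinfun_apply T x) y) = Re (cinner x (blinfun_apply T y))"
      using symmetric_opD(2)[OF T, of x y] by (simp add: inner_eq_Re_cinner)
    show "Im (cinner (blinfun_apply T x) y) = Im (cinner x (blinfun_apply T y))"
      using symmetric_opD(2)[OF T, of "(-\<i>) *\<^sub>C x" y] symmetric_opD(1)[OF T]
      by (simp add: Im_cinner bounded_ops_def)
  qed
  then show "T \<in> bounded_ops \<and> adj_op T = T" using adj_op_eqI symmetric_opD(1)[OF T] by blast
next
  assume "T \<in> bounded_ops \<and> adj_op T = T"
  then show "symmetric_op T" using inner_adj_op[of T] by (simp add: symmetric_op_def)
qed

text \<open>Zero padding, so that polynomials of different degrees can be summed over one
  range.\<close>

lemma poly_op_eq_sum: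
  assumes "degree q \<le> n"
  shows "poly_op q T = (\<Sum>i\<le>n. coeff q i *\<^sub>R (((o\<^sub>L) T ^^ i) id_blinfun))"
  unfolding poly_op_def
  by (rule sum.mono_neutral_left) (use assms in \<open>auto simp: coeff_eq_0\<close>)

lemma poly_op_0 [simp]: "poly_op 0 T = 0"
  by (simp add: poly_op_def)

text \<open>Horner's rule; it opens \<open>poly_op\<close> to induction over
  \<open>pCons\<close>.\<close>

lemma poly_op_pCons: "poly_op (pCons a q) T = a *\<^sub>R id_blinfun + (T o\<^sub>L poly_op q T)"
proof -
  have "poly_op (pCons a q) T
      = (\<Sum>i\<le>Suc (degree q). coeff (pCons a q) i *\<^sub>R (((o\<^sub>L) T ^^ i) id_blinfun))"
    by (rule poly_op_eq_sum) (rule degree_pCons_le)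
  also have "\<dots> = a *\<^sub>R id_blinfun
      + (\<Sum>i\<le>degree q. coeff q i *\<^sub>R (T o\<^sub>L (((o\<^sub>L) T ^^ i) id_blinfun)))"
    by (simp only: sum.atMost_Suc_shift) simp
  also have "(\<Sum>i\<le>degree q. coeff q i *\<^sub>R (T o\<^sub>L (((o\<^sub>L) T ^^ i) id_blinfun)))
      = T o\<^sub>L poly_op q T"
    unfolding poly_op_def
    by (simp add: bounded_bilinear.sum_right[OF bounded_bilinear_blinfun_compose]
        bounded_bilinear.scaleR_right[OF bounded_bilinear_blinfun_compose])
  finally show ?thesis .
qed

lemma poly_op_add: "poly_op (p + q) T = poly_op p T + poly_op q T"
proof -
  define n where "n = max (degree p) (degree q)"
  have "degree (p + q) \<le> n" "degree p \<le> n" "degree q \<le> n"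
    by (auto simp: n_def degree_add_le_max)
  then show ?thesis
    by (simp add: poly_op_eq_sum[of _ n] sum.distrib scaleR_add_left)
qed

lemma poly_op_smult: "poly_op (smult a q) T = a *\<^sub>R poly_op q T"
  by (simp add: poly_op_eq_sum[of _ "degree q"] degree_smult_le poly_op_def scaleR_sum_right)

lemma poly_op_minus: "poly_op (- q) T = - poly_op q T"
  using poly_op_smult[of "-1" q T] by simp

lemma poly_op_diff: "poly_op (p - q) T = poly_op p T - poly_op q T"
  using poly_op_add[of p "- q" T] by (simp add: poly_op_minus)

lemma poly_op_mult: "poly_op (p * q) T = poly_op p T o\<^sub>L poly_op q T"
proof (induction p)
  case (pCons a p)
  then show ?case
    by (intro blinfun_eqI)
       (simp add: mult_pCons_left poly_op_add poly_op_smult poly_op_pCons blinfun.bilinear_simps)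
qed simp

lemma poly_op_const: "poly_op [:a:] T = a *\<^sub>R id_blinfun"
  by (simp add: poly_op_pCons)

lemma poly_op_linear: "poly_op [:a, b:] T = a *\<^sub>R id_blinfun + b *\<^sub>R T"
  by (rule blinfun_eqI) (simp add: poly_op_pCons blinfun.bilinear_simps)

text \<open>The polynomial x (4 - x) detects a spectrum inside {0, 4}; it carries the commutation
  test for skew-adjoint unitaries.\<close>

lemma poly_op_two_point:
  "poly_op [:0, 4, - 1:] T = 4 *\<^sub>R T - (T o\<^sub>L T)"
  by (simp add: blinfun_eq_iff poly_op_pCons blinfun.bilinear_simps)

lemma poly_op_commute: "poly_op p T o\<^sub>L poly_op q T = poly_op q T o\<^sub>L poly_op p T"
  by (metis mult.commute poly_op_mult)

lemma poly_op_commute_self: "T o\<^sub>L poly_op q T = poly_op q T o\<^sub>L T"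
  using poly_op_commute[of "[:0,1:]" T q] by (simp add: poly_op_linear)

lemma poly_op_symmetric:
  assumes "symmetric_op T"
  shows "symmetric_op (poly_op q T)"
proof (induction q)
  case 0
  then show ?case by (simp add: symmetric_op_def bounded_ops_intros)
next
  case (pCons a q)
  have c: "blinfun_apply T (blinfun_apply (poly_op q T) y)
      = blinfun_apply (poly_op q T) (blinfun_apply T y)" for y
    using poly_op_commute_self[of T q] by (metis blinfun_apply_blinfun_compose)
  have "inner (blinfun_apply (poly_op (pCons a q) T) x) y
      = inner x (blinfun_apply (poly_op (pCons a q) T) y)" for x y
    using symmetric_opD(2)[OF assms, of "blinfun_apply (poly_op q T) x" y]
      symmetric_opD(2)[OF pCons(2), of x "blinfun_apply T y"]
    by (simp add: poly_op_pCons blinfun.bilinear_simps inner_simps c)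
  moreover have "poly_op (pCons a q) T \<in> bounded_ops"
    unfolding poly_op_pCons
    using symmetric_opD(1)[OF assms] symmetric_opD(1)[OF pCons(2)] by (intro bounded_ops_intros)
  ultimately show ?case by (simp add: symmetric_op_def)
qed

text \<open>The part of the spectrum that matters for \<open>cfc\<close>, whose defining clause
  tests \<open>spectrum_op\<close> at real arguments.\<close>

definition real_spectrum :: "('h::complex_hilbert_space \<Rightarrow>\<^sub>L 'h) \<Rightarrow> real set" where
  "real_spectrum T = {x. complex_of_real x \<in> spectrum_op T}"

lemma real_spectrum_iff: "x \<in> real_spectrum T \<longleftrightarrow> \<not> invertible_op (T - x *\<^sub>R id_blinfun)"
  by (simp add: real_spectrum_def spectrum_op_def invertible_op_def scalar_op_of_real)

lemma invertible_op_compose: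
  assumes "invertible_op A" "invertible_op B"
  shows "invertible_op (A o\<^sub>L B)"
proof -
  obtain C D where C: "C \<in> bounded_ops" "C o\<^sub>L A = id_blinfun" "A o\<^sub>L C = id_blinfun"
    and D: "D \<in> bounded_ops" "D o\<^sub>L B = id_blinfun" "B o\<^sub>L D = id_blinfun"
    using assms by (auto simp: invertible_op_def)
  have "\<And>x. blinfun_apply C (blinfun_apply A x) = x" "\<And>x. blinfun_apply A (blinfun_apply C x) = x"
    "\<And>x. blinfun_apply D (blinfun_apply B x) = x" "\<And>x. blinfun_apply B (blinfun_apply D x) = x"
    using C D by (metis blinfun_apply_blinfun_compose blinfun_apply_id_blinfun id_apply)+
  then have "(D o\<^sub>L C) o\<^sub>L (A o\<^sub>L B) = id_blinfun" "(A o\<^sub>L B) o\<^sub>L (D o\<^sub>L C) = id_blinfun"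
    by (auto intro!: blinfun_eqI)
  then show ?thesis unfolding invertible_op_def using bounded_ops_intros(7)[OF D(1) C(1)] by blast
qed

text \<open>If C inverts A B and A, B commute, then C commutes with B, and B C inverts A on both
  sides.\<close>

lemma invertible_op_factor:
  assumes "invertible_op (A o\<^sub>L B)" "A o\<^sub>L B = B o\<^sub>L A" "B \<in> bounded_ops"
  shows "invertible_op A"
proof -
  obtain C where C: "C \<in> bounded_ops" "C o\<^sub>L (A o\<^sub>L B) = id_blinfun" "(A o\<^sub>L B) o\<^sub>L C = id_blinfun"
    using assms(1) by (auto simp: invertible_op_def)
  have 1: "blinfun_apply C (blinfun_apply B (blinfun_apply A x)) = x" for x
    using C(2) assms(2) by (metis blinfun_apply_blinfun_compose blinfun_apply_id_blinfun id_apply)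
  have 2: "blinfun_apply A (blinfun_apply B (blinfun_apply C x)) = x" for x
    using C(3) by (metis blinfun_apply_blinfun_compose blinfun_apply_id_blinfun id_apply)
  have 3: "blinfun_apply C (blinfun_apply B x) = blinfun_apply B (blinfun_apply C x)" for x
    by (metis 1 2)
  have "(B o\<^sub>L C) o\<^sub>L A = id_blinfun" "A o\<^sub>L (B o\<^sub>L C) = id_blinfun"
    by (auto intro!: blinfun_eqI simp: 1 2) (metis 1 3)
  then show ?thesis unfolding invertible_op_def using bounded_ops_intros(7)[OF assms(3) C(1)] by blast
qed

lemma invertible_op_minus_iff: "invertible_op (- A) \<longleftrightarrow> invertible_op A"
proof -
  have "invertible_op (- A)" if "invertible_op A" for A :: "'a::complex_hilbert_space \<Rightarrow>\<^sub>L 'a"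
  proof -
    obtain C where C: "C \<in> bounded_ops" "C o\<^sub>L A = id_blinfun" "A o\<^sub>L C = id_blinfun"
      using \<open>invertible_op A\<close> unfolding invertible_op_def by blast
    have "(- C) o\<^sub>L (- A) = id_blinfun" "(- A) o\<^sub>L (- C) = id_blinfun"
      by (simp_all add: C bounded_bilinear.minus_left[OF bounded_bilinear_blinfun_compose]
        bounded_bilinear.minus_right[OF bounded_bilinear_blinfun_compose])
    then show ?thesis unfolding invertible_op_def using bounded_ops_intros(5)[OF C(1)] by blast
  qed
  from this[of A] this[of "- A"] show ?thesis by auto
qed

lemma invertible_op_scaleR_id:
  assumes "a \<noteq> 0"
  shows "invertible_op (a *\<^sub>R id_blinfun)"
proof -
  have "(inverse a *\<^sub>R id_blinfun) o\<^sub>L (a *\<^sub>R id_blinfun) = id_blinfun"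
    "(a *\<^sub>R id_blinfun) o\<^sub>L (inverse a *\<^sub>R id_blinfun) = id_blinfun"
    using assms by (auto intro!: blinfun_eqI simp: blinfun.bilinear_simps)
  then show ?thesis unfolding invertible_op_def using bounded_ops_intros(1,6) by blast
qed

text \<open>For r outside the numerical bounds, \<open>T - r\<close> or its negative is coercive,
  hence invertible.\<close>

lemma real_spectrum_subset_Icc:
  assumes "T \<in> bounded_ops"
    and "\<And>x. a * (norm x)\<^sup>2 \<le> inner (blinfun_apply T x) x"
    and "\<And>x. inner (blinfun_apply T x) x \<le> b * (norm x)\<^sup>2"
  shows "real_spectrum T \<subseteq> {a..b}"
proof
  fix r assume "r \<in> real_spectrum T"
  then have ni: "\<not> invertible_op (T - r *\<^sub>R id_blinfun)" by (simp add: real_spectrum_iff)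
  have e: "inner (blinfun_apply (T - r *\<^sub>R id_blinfun) x) x
      = inner (blinfun_apply T x) x - r * (norm x)\<^sup>2" for x
    by (simp add: blinfun.bilinear_simps inner_simps power2_norm_eq_inner)
  have bo: "T - r *\<^sub>R id_blinfun \<in> bounded_ops" "- (T - r *\<^sub>R id_blinfun) \<in> bounded_ops"
    using assms(1) by (intro bounded_ops_intros; simp)+
  have "a \<le> r"
  proof (rule ccontr)
    assume "\<not> a \<le> r"
    then have "invertible_op (T - r *\<^sub>R id_blinfun)"
      by (intro coercive_invertible[OF bo(1), of "a - r"])
         (use assms(2) e in \<open>auto simp: algebra_simps\<close>)
    then show False using ni by blast
  qed
  moreover have "r \<le> b"
  proof (rule ccontr)
    assume "\<not> r \<le> b"
    then have "invertible_op (- (T - r *\<^sub>R id_blinfun))"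
      by (intro coercive_invertible[OF bo(2), of "r - b"])
         (use assms(3) e in \<open>auto simp: blinfun.minus_left left_diff_distrib simp del: minus_diff_eq\<close>)
    then show False using ni invertible_op_minus_iff by blast
  qed
  ultimately show "r \<in> {a..b}" by simp
qed

lemma real_spectrum_le_norm:
  assumes "T \<in> bounded_ops" "r \<in> real_spectrum T"
  shows "\<bar>r\<bar> \<le> norm T"
proof -
  have "\<bar>inner (blinfun_apply T x) x\<bar> \<le> norm T * (norm x)\<^sup>2" for x
  proof -
    have "\<bar>inner (blinfun_apply T x) x\<bar> \<le> norm (blinfun_apply T x) * norm x"
      by (rule Cauchy_Schwarz_ineq2)
    also have "\<dots> \<le> norm T * norm x * norm x"
      by (intro mult_right_mono norm_blinfun) simp
    finally show ?thesis by (simp add: power2_eq_square mult_ac)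
  qed
  then have "- norm T * (norm x)\<^sup>2 \<le> inner (blinfun_apply T x) x"
    "inner (blinfun_apply T x) x \<le> norm T * (norm x)\<^sup>2" for x
    by (auto simp: abs_le_iff minus_le_iff)
  then have "real_spectrum T \<subseteq> {- norm T..norm T}"
    by (rule real_spectrum_subset_Icc[OF assms(1)])
  then show ?thesis using assms(2) by (auto simp: abs_le_iff)
qed

text \<open>On unit vectors where |B x| is almost maximal, (B^2 - m^2) x is almost zero, so B^2 -
  m^2 is not bounded below. Quantitatively, an inverse would give |B x|^2 <= (m^2 - 1/K) |x|^2,
  against the choice of m as the norm.\<close>

lemma norm_sq_not_invertible:
  fixes B :: "'h::complex_hilbert_space \<Rightarrow>\<^sub>L 'h"
  assumes B: "symmetric_op B" and nt: "(id_blinfun :: 'h \<Rightarrow>\<^sub>L 'h) \<noteq> 0"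
  shows "\<not> invertible_op ((B o\<^sub>L B) - (norm B)\<^sup>2 *\<^sub>R id_blinfun)"
proof
  define m where "m = norm B"
  assume "invertible_op ((B o\<^sub>L B) - (norm B)\<^sup>2 *\<^sub>R id_blinfun)"
  then obtain C where C: "C o\<^sub>L ((B o\<^sub>L B) - m\<^sup>2 *\<^sub>R id_blinfun) = id_blinfun"
    by (auto simp: invertible_op_def m_def)
  define D where "D x = blinfun_apply B (blinfun_apply B x) - m\<^sup>2 *\<^sub>R x" for x
  have D: "blinfun_apply C (D x) = x" for x
    using arg_cong[OF C, of "\<lambda>E. blinfun_apply E x"] by (simp add: D_def blinfun.bilinear_simps)
  have Dn: "(norm (D x))\<^sup>2 \<le> m\<^sup>2 * (m\<^sup>2 * (norm x)\<^sup>2 - (norm (blinfun_apply B x))\<^sup>2)" for x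
  proof -
    have "(norm (D x))\<^sup>2 = (norm (blinfun_apply B (blinfun_apply B x)))\<^sup>2
        - 2 * m\<^sup>2 * inner (blinfun_apply B (blinfun_apply B x)) x + m\<^sup>2 * m\<^sup>2 * (norm x)\<^sup>2"
      unfolding D_def power2_norm_eq_inner
      by (simp add: inner_simps inner_commute power2_eq_square algebra_simps)
    also have "inner (blinfun_apply B (blinfun_apply B x)) x = (norm (blinfun_apply B x))\<^sup>2"
      by (simp add: symmetric_opD(2)[OF B] power2_norm_eq_inner)
    finally have "(norm (D x))\<^sup>2 = (norm (blinfun_apply B (blinfun_apply B x)))\<^sup>2
        - 2 * m\<^sup>2 * (norm (blinfun_apply B x))\<^sup>2 + m\<^sup>2 * m\<^sup>2 * (norm x)\<^sup>2" .
    moreover have "(norm (blinfun_apply B (blinfun_apply B x)))\<^sup>2 \<le> (m * norm (blinfun_apply B x))\<^sup>2"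
      unfolding m_def by (intro power_mono norm_blinfun) simp
    ultimately show ?thesis by (simp add: power_mult_distrib algebra_simps)
  qed
  define K where "K = (norm C)\<^sup>2 * m\<^sup>2"
  have bd: "(norm x)\<^sup>2 \<le> K * (m\<^sup>2 * (norm x)\<^sup>2 - (norm (blinfun_apply B x))\<^sup>2)" for x
  proof -
    have "(norm x)\<^sup>2 \<le> (norm C * norm (D x))\<^sup>2"
      using norm_blinfun[of C "D x"] D[of x] by (simp add: power_mono)
    also have "\<dots> \<le> (norm C)\<^sup>2 * (m\<^sup>2 * (m\<^sup>2 * (norm x)\<^sup>2 - (norm (blinfun_apply B x))\<^sup>2))"
      unfolding power_mult_distrib by (intro mult_left_mono Dn) simp
    finally show ?thesis by (simp add: K_def mult_ac)
  qed
  obtain x0 :: 'h where "x0 \<noteq> 0"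
    using nt by (metis blinfun_apply_id_blinfun blinfun_eqI id_apply zero_blinfun.rep_eq)
  then have "K \<noteq> 0" using bd[of x0] by auto
  then have K: "K > 0" unfolding K_def by (simp add: less_le)
  then have m: "m > 0" by (simp add: K_def m_def zero_less_mult_iff)
  have le: "(norm (blinfun_apply B x))\<^sup>2 \<le> (m\<^sup>2 - 1 / K) * (norm x)\<^sup>2" for x
    using bd[of x] K by (simp add: field_simps)
  have "0 \<le> (m\<^sup>2 - 1 / K) * (norm x0)\<^sup>2" using le[of x0] zero_le_power2 order_trans by blast
  then have nn: "0 \<le> m\<^sup>2 - 1 / K" using \<open>x0 \<noteq> 0\<close> by (simp add: zero_le_mult_iff)
  have "norm B \<le> sqrt (m\<^sup>2 - 1 / K)"
  proof (rule norm_blinfun_bound)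
    show "norm (blinfun_apply B x) \<le> sqrt (m\<^sup>2 - 1 / K) * norm x" for x
    proof (rule power2_le_imp_le)
      show "(norm (blinfun_apply B x))\<^sup>2 \<le> (sqrt (m\<^sup>2 - 1 / K) * norm x)\<^sup>2"
        using le[of x] nn by (simp add: power_mult_distrib)
    qed (use nn in simp)
  qed (use nn in simp)
  then have "m\<^sup>2 \<le> m\<^sup>2 - 1 / K" 
    using power_mono[of "norm B" "sqrt (m\<^sup>2 - 1 / K)" 2] nn by (simp add: m_def)
  then show False using K by simp
qed

lemma poly_map_of_real_mult:
  "map_poly complex_of_real (p * q) = map_poly of_real p * map_poly of_real q"
  by (rule poly_eqI) (simp add: coeff_map_poly coeff_mult)

lemma poly_map_of_real_add:
  "map_poly complex_of_real (p + q) = map_poly of_real p + map_poly of_real q"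
  by (rule poly_eqI) (simp add: coeff_map_poly)

lemma poly_map_of_real: "poly (map_poly complex_of_real p) (of_real x) = of_real (poly p x)"
  by (induction p) (auto simp: map_poly_pCons)

text \<open>Take a complex root z. If it is not real, divide by its minimal real quadratic: the
  remainder is real of degree at most one and vanishes at the nonreal z, hence is zero.\<close>

lemma real_poly_factor:
  fixes s :: "real poly"
  assumes "degree s \<noteq> 0"
  shows "(\<exists>r t. s = [:- r, 1:] * t) \<or> (\<exists>a b t. b \<noteq> 0 \<and> s = ([:- a, 1:]\<^sup>2 + [:b\<^sup>2:]) * t)"
proof -
  let ?S = "map_poly complex_of_real"
  have "\<not> constant (poly (?S s))"
    using assms by (simp add: constant_degree degree_map_poly)
  then obtain z where z: "poly (?S s) z = 0" using fundamental_theorem_of_algebra by blast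
  show ?thesis
  proof (cases "Im z = 0")
    case True
    then have "z = of_real (Re z)" by (simp add: complex_eq_iff)
    then have "poly s (Re z) = 0" using z poly_map_of_real[of s "Re z"] by simp
    then have "[:- Re z, 1:] dvd s" by (simp add: poly_eq_0_iff_dvd)
    then show ?thesis by (auto simp: dvd_def)
  next
    case False
    define Q where "Q = [:- Re z, 1:]\<^sup>2 + [:(Im z)\<^sup>2:]"
    have Qe: "Q = [:(Re z)\<^sup>2 + (Im z)\<^sup>2, - 2 * Re z, 1:]"
      by (simp add: Q_def power2_eq_square)
    have Qz: "poly (?S Q) z = 0"
      unfolding Qe by (simp add: map_poly_pCons complex_eq_iff power2_eq_square algebra_simps)
    have "degree (s mod Q) < degree Q \<or> s mod Q = 0"
      using degree_mod_less[of Q s] by (auto simp: Qe)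
    then have "degree (s mod Q) \<le> 1" by (auto simp: Qe)
    then obtain c d where R: "s mod Q = [:c, d:]"
      by (metis One_nat_def degree1_coeffs degree_0 le_SucE le_zero_eq degree_eq_zeroE pCons_0_0 degree_pCons_eq_if)
    have "poly (?S (Q * (s div Q) + s mod Q)) z = 0" using z by simp
    then have "poly (?S [:c, d:]) z = 0"
      unfolding poly_map_of_real_add poly_map_of_real_mult poly_add poly_mult Qz R by simp
    then have "c + d * Re z = 0" "d * Im z = 0"
      by (auto simp: map_poly_pCons complex_eq_iff mult.commute)
    then have "s mod Q = 0" using False R by simp
    then have "s = Q * (s div Q)" by (metis add.right_neutral mult_div_mod_eq)
    then show ?thesis using False unfolding Q_def by blast
  qed
qed

text \<open>Peel off real factors. A quadratic (T - a)^2 + b^2 is coercive with constant b^2 and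
  never spoils invertibility, and a linear factor does so only at a spectral point. A nonzero
  constant is left at the end.\<close>

lemma poly_op_not_invertible_root:
  assumes "symmetric_op T" "s \<noteq> 0" "\<not> invertible_op (poly_op s T)"
  shows "\<exists>r\<in>real_spectrum T. poly s r = 0"
  using assms(2,3)
proof (induction "degree s" arbitrary: s rule: less_induct)
  case less
  show ?case
  proof (cases "degree s = 0")
    case True
    then obtain a where "s = [:a:]" by (rule degree_eq_zeroE)
    then show ?thesis using less.prems invertible_op_scaleR_id[of a] by (auto simp: poly_op_const)
  next
    case False
    then consider r t where "s = [:- r, 1:] * t"
      | a b t where "b \<noteq> 0" "s = ([:- a, 1:]\<^sup>2 + [:b\<^sup>2:]) * t"
      using real_poly_factor by blast
    then show ?thesis
    proof cases
      case 1
      then have t: "t \<noteq> 0" "degree t < degree s" using less.prems by (auto simp: degree_mult_eq simp del: mult_pCons_left)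
      show ?thesis
      proof (cases "r \<in> real_spectrum T")
        case True
        then show ?thesis using 1 by (intro bexI[of _ r]) auto
      next
        case False
        have "poly_op [:- r, 1:] T = T - r *\<^sub>R id_blinfun" by (simp add: poly_op_linear)
        then have "\<not> invertible_op (poly_op t T)"
          using less.prems(2) invertible_op_compose False
          unfolding 1 poly_op_mult real_spectrum_iff by metis
        then show ?thesis using less.hyps[OF t(2,1)] 1 by auto
      qed
    next
      case 2
      let ?Q = "[:- a, 1:]\<^sup>2 + [:b\<^sup>2:]"
      have "?Q = [:a\<^sup>2 + b\<^sup>2, - 2 * a, 1:]" by (simp add: power2_eq_square)
      then have dQ: "degree ?Q = 2" by simp
      then have t: "t \<noteq> 0" "degree t < degree s"
        using less.prems 2 by (auto simp: degree_mult_eq simp del: mult_pCons_left)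
      define L where "L = poly_op [:- a, 1:] T"
      have L: "symmetric_op L" unfolding L_def by (rule poly_op_symmetric[OF assms(1)])
      have Q: "poly_op ?Q T = (L o\<^sub>L L) + b\<^sup>2 *\<^sub>R id_blinfun"
        by (simp only: poly_op_add poly_op_const power2_eq_square poly_op_mult L_def)
      have "invertible_op (poly_op ?Q T)"
      proof (rule coercive_invertible[of _ "b\<^sup>2"])
        show "poly_op ?Q T \<in> bounded_ops" using poly_op_symmetric[OF assms(1)] symmetric_opD(1) by blast
        show "b\<^sup>2 * (norm x)\<^sup>2 \<le> inner (blinfun_apply (poly_op ?Q T) x) x" for x
          unfolding Q using symmetric_opD(2)[OF L, of "blinfun_apply L x" x]
          by (simp add: blinfun.bilinear_simps inner_simps power2_norm_eq_inner)
      qed (use 2 in simp)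
      then have "\<not> invertible_op (poly_op t T)"
        using less.prems(2) invertible_op_compose unfolding 2(2) poly_op_mult by metis
      then obtain r where "r \<in> real_spectrum T" "poly t r = 0" using less.hyps[OF t(2,1)] by blast
      then show ?thesis using 2(2) by (intro bexI[of _ r]) auto
    qed
  qed
qed

text \<open>The operator q(T)^2 - m^2 with m the norm of q(T) is not invertible, so the polynomial
  q^2 - m^2 has a root in the spectrum.\<close>

lemma norm_poly_op_attained:
  fixes T :: "'h::complex_hilbert_space \<Rightarrow>\<^sub>L 'h"
  assumes T: "symmetric_op T" and nt: "(id_blinfun :: 'h \<Rightarrow>\<^sub>L 'h) \<noteq> 0"
  shows "\<exists>r\<in>real_spectrum T. norm (poly_op q T) = \<bar>poly q r\<bar>"
proof -
  have *: "\<exists>r\<in>real_spectrum T. norm (poly_op q T) = \<bar>poly q r\<bar>"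
    if nz: "q * q - [:(norm (poly_op q T))\<^sup>2:] \<noteq> 0" for q
  proof -
    have "poly_op (q * q - [:(norm (poly_op q T))\<^sup>2:]) T
        = (poly_op q T o\<^sub>L poly_op q T) - (norm (poly_op q T))\<^sup>2 *\<^sub>R id_blinfun"
      by (simp add: poly_op_diff poly_op_mult poly_op_const)
    then obtain r where "r \<in> real_spectrum T" "poly (q * q - [:(norm (poly_op q T))\<^sup>2:]) r = 0"
      using poly_op_not_invertible_root[OF T nz]
        norm_sq_not_invertible[OF poly_op_symmetric[OF T] nt] by metis
    then show ?thesis
      by (intro bexI[of _ r]) (auto simp: power2_eq_square[symmetric] power2_eq_iff)
  qed
  show ?thesis
  proof (cases "q * q - [:(norm (poly_op q T))\<^sup>2:] = 0")
    case True
    \<comment> \<open>If q^2 - m^2 is the zero polynomial, any spectral point will do. One exists by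
      the general case for q = x, where q^2 - m^2 has degree two.\<close>
    have "[:0, 1:] * [:0, 1:] - [:(norm (poly_op [:0, 1:] T))\<^sup>2:] \<noteq> (0 :: real poly)" by simp
    then obtain r where r: "r \<in> real_spectrum T" using * by blast
    have "poly (q * q - [:(norm (poly_op q T))\<^sup>2:]) r = 0" using True by simp
    then show ?thesis using r
      by (intro bexI[of _ r]) (auto simp: power2_eq_square[symmetric] power2_eq_iff)
  qed (rule *)
qed

text \<open>Spectral inclusion: x - r divides q - q(r), so an inverse of q(T) - q(r) would yield one
  of T - r. The value q(r) thus lies in the spectrum of q(T), which the norm bounds.\<close>

lemma norm_poly_op_ge:
  assumes T: "symmetric_op T" and r: "r \<in> real_spectrum T"
  shows "\<bar>poly q r\<bar> \<le> norm (poly_op q T)"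
proof -
  obtain t where t: "q - [:poly q r:] = [:- r, 1:] * t"
    using poly_eq_0_iff_dvd[of "q - [:poly q r:]" r] by (auto simp: dvd_def)
  have "poly_op q T - poly q r *\<^sub>R id_blinfun = poly_op [:- r, 1:] T o\<^sub>L poly_op t T"
    using arg_cong[OF t, of "\<lambda>q. poly_op q T"] by (simp only: poly_op_diff poly_op_const poly_op_mult)
  moreover have "poly_op [:- r, 1:] T = T - r *\<^sub>R id_blinfun" by (simp add: poly_op_linear)
  ultimately have "poly q r \<in> real_spectrum (poly_op q T)"
    using r invertible_op_factor[OF _ poly_op_commute] symmetric_opD(1)[OF poly_op_symmetric[OF T]]
    unfolding real_spectrum_iff by metis
  then show ?thesis using real_spectrum_le_norm symmetric_opD(1)[OF poly_op_symmetric[OF T]] by blast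
qed

section \<open>Continuous functional calculus\<close>

lemma Weierstrass_poly:
  fixes f :: "real \<Rightarrow> real"
  assumes "continuous_on {a..b} f"
  obtains p :: "nat \<Rightarrow> real poly" where "uniform_limit {a..b} (\<lambda>n. poly (p n)) f sequentially"
proof -
  have "\<exists>q. \<forall>x\<in>{a..b}. \<bar>f x - poly q x\<bar> < inverse (real (Suc n))" for n
  proof -
    obtain g where g: "real_polynomial_function g" "\<And>x. x \<in> {a..b} \<Longrightarrow> \<bar>f x - g x\<bar> < inverse (real (Suc n))"
      using Stone_Weierstrass_real_polynomial_function[OF compact_Icc assms, of "inverse (real (Suc n))"]
      by auto
    obtain c m where "g = (\<lambda>x. \<Sum>i\<le>m. c i * x ^ i)"
      using g(1) unfolding real_polynomial_function_iff_sum by blast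
    then have "g x = poly (\<Sum>i\<le>m. monom (c i) i) x" for x by (simp add: poly_sum poly_monom)
    then show ?thesis using g(2) by metis
  qed
  then obtain p where p: "\<And>n x. x \<in> {a..b} \<Longrightarrow> \<bar>f x - poly (p n) x\<bar> < inverse (real (Suc n))"
    by metis
  have "uniform_limit {a..b} (\<lambda>n. poly (p n)) f sequentially"
  proof (rule uniform_limitI)
    fix e :: real assume "e > 0"
    then have "\<forall>\<^sub>F n in sequentially. inverse (real (Suc n)) < e"
      using LIMSEQ_inverse_real_of_nat by (rule order_tendstoD(2)[rotated])
    then show "\<forall>\<^sub>F n in sequentially. \<forall>x\<in>{a..b}. dist (poly (p n) x) (f x) < e"
    proof eventually_elim
      case (elim n)
      show ?case
      proof
        fix x assume "x \<in> {a..b}"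
        then show "dist (poly (p n) x) (f x) < e"
          using p[of x n] elim by (simp add: dist_real_def abs_minus_commute)
      qed
    qed
  qed
  then show ?thesis using that by blast
qed

text \<open>Standing assumptions of the calculus. The left end is 0 because it is applied to
  operators of the form adjoint times operator and to nonnegative functions of them; on a nonzero
  space the spectrum is nonempty.\<close>

definition spectrum_in :: "('h::complex_hilbert_space \<Rightarrow>\<^sub>L 'h) \<Rightarrow> real \<Rightarrow> bool" where
  "spectrum_in T M \<longleftrightarrow> symmetric_op T \<and> real_spectrum T \<subseteq> {0..M} \<and> (id_blinfun :: 'h \<Rightarrow>\<^sub>L 'h) \<noteq> 0"

lemma spectrum_inD:
  fixes T :: "'h::complex_hilbert_space \<Rightarrow>\<^sub>L 'h"
  assumes "spectrum_in T M"
  shows "symmetric_op T" "real_spectrum T \<subseteq> {0..M}" "(id_blinfun :: 'h \<Rightarrow>\<^sub>L 'h) \<noteq> 0"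
  using assms by (auto simp: spectrum_in_def)

lemma norm_poly_op_le:
  assumes "spectrum_in T M" "\<And>x. x \<in> real_spectrum T \<Longrightarrow> \<bar>poly q x\<bar> \<le> d"
  shows "norm (poly_op q T) \<le> d"
  using norm_poly_op_attained[OF spectrum_inD(1,3)[OF assms(1)], of q] assms(2) by auto

lemma cfc_cong:
  assumes "\<And>x. x \<in> real_spectrum T \<Longrightarrow> f x = g x"
  shows "cfc f T = cfc g T"
proof -
  have "(\<forall>x. complex_of_real x \<in> spectrum_op T \<longrightarrow> \<bar>poly q x - f x\<bar> < d) \<longleftrightarrow>
        (\<forall>x. complex_of_real x \<in> spectrum_op T \<longrightarrow> \<bar>poly q x - g x\<bar> < d)" for q d
    using assms by (auto simp: real_spectrum_def)
  then show ?thesis unfolding cfc_def by simp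
qed

text \<open>This replaces the definite description by a limit along any uniformly convergent
  sequence. Approximation on the whole interval suffices because it contains the spectrum, where the
  norms of polynomials are attained.\<close>

lemma cfc_LIMSEQ:
  assumes T: "spectrum_in T M" and p: "uniform_limit {0..M} (\<lambda>n. poly (p n)) f sequentially"
  shows "(\<lambda>n. poly_op (p n) T) \<longlonglongrightarrow> cfc f T"
proof -
  have ev: "\<forall>\<^sub>F n in sequentially. \<forall>x\<in>real_spectrum T. \<bar>poly (p n) x - f x\<bar> < e" if "e > 0" for e
    using uniform_limitD[OF p that]
    by eventually_elim (use spectrum_inD(2)[OF T] in \<open>auto simp: dist_real_def\<close>)
  have "Cauchy (\<lambda>n. poly_op (p n) T)"
  proof (rule metric_CauchyI)
    fix e :: real assume e: "e > 0"
    then obtain n0 where n0: "\<And>n x. n \<ge> n0 \<Longrightarrow> x \<in> real_spectrum T \<Longrightarrow> \<bar>poly (p n) x - f x\<bar> < e / 4"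
      using ev[of "e / 4"] by (auto simp: eventually_sequentially)
    have "dist (poly_op (p m) T) (poly_op (p n) T) < e" if "m \<ge> n0" "n \<ge> n0" for m n
    proof -
      have "norm (poly_op (p m - p n) T) \<le> e / 2"
      proof (rule norm_poly_op_le[OF T])
        fix x assume "x \<in> real_spectrum T"
        then show "\<bar>poly (p m - p n) x\<bar> \<le> e / 2"
          using n0[OF that(1), of x] n0[OF that(2), of x] unfolding poly_diff by linarith
      qed
      then show ?thesis using e by (simp add: poly_op_diff dist_norm)
    qed
    then show "\<exists>M. \<forall>m\<ge>M. \<forall>n\<ge>M. dist (poly_op (p m) T) (poly_op (p n) T) < e" by blast
  qed
  then obtain S where S: "(\<lambda>n. poly_op (p n) T) \<longlonglongrightarrow> S"
    using Cauchy_convergent unfolding convergent_def by blast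
  \<comment> \<open>Compare \<open>q\<close> with a late approximant \<open>p n\<close>. The clause
    in \<open>cfc\<close> then follows with tolerance e / 2, where halving restores the strict
    inequality.\<close>
  have bound: "norm (poly_op q T - S) \<le> d"
    if q: "\<And>x. x \<in> real_spectrum T \<Longrightarrow> \<bar>poly q x - f x\<bar> \<le> d" for q d
  proof (rule field_le_epsilon)
    fix e :: real assume e: "e > 0"
    have "\<forall>\<^sub>F n in sequentially. norm (poly_op (p n) T - S) < e / 2"
      using tendstoD[OF S, of "e / 2"] e by (simp add: dist_norm)
    moreover have "\<forall>\<^sub>F n in sequentially. \<forall>x\<in>real_spectrum T. \<bar>poly (p n) x - f x\<bar> < e / 2"
      using ev[of "e / 2"] e by simp
    ultimately have "\<forall>\<^sub>F n in sequentially. norm (poly_op (p n) T - S) < e / 2 \<and>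
        (\<forall>x\<in>real_spectrum T. \<bar>poly (p n) x - f x\<bar> < e / 2)"
      by (rule eventually_conj)
    then obtain n where n: "norm (poly_op (p n) T - S) < e / 2"
        "\<And>x. x \<in> real_spectrum T \<Longrightarrow> \<bar>poly (p n) x - f x\<bar> < e / 2"
      using eventually_happens'[OF sequentially_bot] by fast
    have "norm (poly_op (q - p n) T) \<le> d + e / 2"
    proof (rule norm_poly_op_le[OF T])
      fix x assume "x \<in> real_spectrum T"
      then show "\<bar>poly (q - p n) x\<bar> \<le> d + e / 2" using n(2)[of x] q[of x] unfolding poly_diff by linarith
    qed
    then show "norm (poly_op q T - S) \<le> d + e"
      using n(1) norm_triangle_ineq[of "poly_op q T - poly_op (p n) T" "poly_op (p n) T - S"]
      by (simp add: poly_op_diff)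
  qed
  have "cfc f T = S"
    unfolding cfc_def
  proof (rule the_equality)
    show "\<forall>e>0. \<exists>d>0. \<forall>q. (\<forall>x. complex_of_real x \<in> spectrum_op T \<longrightarrow> \<bar>poly q x - f x\<bar> < d) \<longrightarrow>
        norm (poly_op q T - S) < e"
    proof (intro allI impI)
      fix e :: real assume e: "e > 0"
      have "norm (poly_op q T - S) < e"
        if "\<forall>x. complex_of_real x \<in> spectrum_op T \<longrightarrow> \<bar>poly q x - f x\<bar> < e / 2" for q
        using bound[of q "e / 2"] that e by (fastforce simp: real_spectrum_def)
      then show "\<exists>d>0. \<forall>q. (\<forall>x. complex_of_real x \<in> spectrum_op T \<longrightarrow> \<bar>poly q x - f x\<bar> < d) \<longrightarrow>
          norm (poly_op q T - S) < e"
        using e by (intro exI[of _ "e / 2"]) auto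
    qed
  next
    fix S' assume S': "\<forall>e>0. \<exists>d>0. \<forall>q. (\<forall>x. complex_of_real x \<in> spectrum_op T \<longrightarrow>
        \<bar>poly q x - f x\<bar> < d) \<longrightarrow> norm (poly_op q T - S') < e"
    have "(\<lambda>n. poly_op (p n) T) \<longlonglongrightarrow> S'"
    proof (rule tendstoI)
      fix e :: real assume "e > 0"
      then obtain d where d: "d > 0" "\<And>q. (\<forall>x. complex_of_real x \<in> spectrum_op T \<longrightarrow>
        \<bar>poly q x - f x\<bar> < d) \<Longrightarrow> norm (poly_op q T - S') < e" using S' by blast
      show "\<forall>\<^sub>F n in sequentially. dist (poly_op (p n) T) S' < e"
        using ev[OF d(1)]
        by eventually_elim (auto simp: dist_norm real_spectrum_def intro!: d(2))
    qed
    then show "S' = S" using S LIMSEQ_unique by blast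
  qed
  then show ?thesis using S by simp
qed

lemma cfc_poly:
  assumes "spectrum_in T M"
  shows "cfc (poly q) T = poly_op q T"
proof -
  have "(\<lambda>n::nat. poly_op q T) \<longlonglongrightarrow> cfc (poly q) T"
    by (rule cfc_LIMSEQ[OF assms]) (rule uniform_limitI, simp)
  then show ?thesis using LIMSEQ_unique tendsto_const by blast
qed

lemma cfc_const: "spectrum_in T M \<Longrightarrow> cfc (\<lambda>_. a) T = a *\<^sub>R id_blinfun"
  using cfc_poly[of T M "[:a:]"] cfc_cong[of T "poly [:a:]" "\<lambda>_. a"] by (simp add: poly_op_const)

lemma cfc_add:
  assumes "spectrum_in T M" "continuous_on {0..M} f" "continuous_on {0..M} g"
  shows "cfc (\<lambda>x. f x + g x) T = cfc f T + cfc g T"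
proof -
  obtain p where p: "uniform_limit {0..M} (\<lambda>n. poly (p n)) f sequentially"
    using Weierstrass_poly[OF assms(2)] .
  obtain q where q: "uniform_limit {0..M} (\<lambda>n. poly (q n)) g sequentially"
    using Weierstrass_poly[OF assms(3)] .
  have "uniform_limit {0..M} (\<lambda>n. poly (p n + q n)) (\<lambda>x. f x + g x) sequentially"
    using uniform_limit_add[OF p q] by (simp add: fun_eq_iff[symmetric] poly_add[abs_def])
  then have "(\<lambda>n. poly_op (p n) T + poly_op (q n) T) \<longlonglongrightarrow> cfc (\<lambda>x. f x + g x) T"
    using cfc_LIMSEQ[OF assms(1), of "\<lambda>n. p n + q n"] by (simp add: poly_op_add)
  moreover have "(\<lambda>n. poly_op (p n) T + poly_op (q n) T) \<longlonglongrightarrow> cfc f T + cfc g T"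
    by (intro tendsto_add cfc_LIMSEQ[OF assms(1)] p q)
  ultimately show ?thesis using LIMSEQ_unique by blast
qed

lemma cfc_mult:
  assumes "spectrum_in T M" "continuous_on {0..M} f" "continuous_on {0..M} g"
  shows "cfc (\<lambda>x. f x * g x) T = cfc f T o\<^sub>L cfc g T"
proof -
  obtain p where p: "uniform_limit {0..M} (\<lambda>n. poly (p n)) f sequentially"
    using Weierstrass_poly[OF assms(2)] .
  obtain q where q: "uniform_limit {0..M} (\<lambda>n. poly (q n)) g sequentially"
    using Weierstrass_poly[OF assms(3)] .
  have b: "bounded (f ` {0..M})" "bounded (g ` {0..M})"
    using assms by (auto intro: compact_imp_bounded compact_continuous_image)
  have "uniform_limit {0..M} (\<lambda>n. poly (p n * q n)) (\<lambda>x. f x * g x) sequentially"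
    using uniform_lim_mult[OF p q b] by (simp add: poly_mult[abs_def])
  then have "(\<lambda>n. poly_op (p n) T o\<^sub>L poly_op (q n) T) \<longlonglongrightarrow> cfc (\<lambda>x. f x * g x) T"
    using cfc_LIMSEQ[OF assms(1), of "\<lambda>n. p n * q n"] by (simp add: poly_op_mult)
  moreover have "(\<lambda>n. poly_op (p n) T o\<^sub>L poly_op (q n) T) \<longlonglongrightarrow> (cfc f T o\<^sub>L cfc g T)"
    by (intro bounded_bilinear.tendsto[OF bounded_bilinear_blinfun_compose] cfc_LIMSEQ[OF assms(1)] p q)
  ultimately show ?thesis using LIMSEQ_unique by blast
qed

lemma cfc_scaleR:
  assumes "spectrum_in T M" "continuous_on {0..M} f"
  shows "cfc (\<lambda>x. a * f x) T = a *\<^sub>R cfc f T"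
proof -
  have "cfc (\<lambda>x. a * f x) T = (a *\<^sub>R id_blinfun) o\<^sub>L cfc f T"
    using cfc_mult[OF assms(1) continuous_on_const assms(2), of a] cfc_const[OF assms(1), of a] by simp
  also have "\<dots> = a *\<^sub>R cfc f T" by (rule blinfun_eqI) (simp add: blinfun.scaleR_left)
  finally show ?thesis .
qed

text \<open>Transfers properties from polynomials in T to functions of T, namely symmetry and
  membership in the algebra.\<close>

lemma cfc_in_closed:
  assumes "spectrum_in T M" "continuous_on {0..M} f" "closed C" "\<And>q. poly_op q T \<in> C"
  shows "cfc f T \<in> C"
proof -
  obtain p where p: "uniform_limit {0..M} (\<lambda>n. poly (p n)) f sequentially"
    using Weierstrass_poly[OF assms(2)] .
  show ?thesis
    using closed_sequentially[OF assms(3) _ cfc_LIMSEQ[OF assms(1) p]] assms(4) by blast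
qed

text \<open>Limits of the two polynomial estimates. The second one turns \<open>cfc f T = 0\<close>
  into the vanishing of f on the spectrum.\<close>

lemma cfc_norm_bounds:
  assumes "spectrum_in T M" "continuous_on {0..M} f"
  shows "(\<And>x. x \<in> {0..M} \<Longrightarrow> \<bar>f x\<bar> \<le> d) \<Longrightarrow> norm (cfc f T) \<le> d"
    and "r \<in> real_spectrum T \<Longrightarrow> \<bar>f r\<bar> \<le> norm (cfc f T)"
proof -
  obtain p where p: "uniform_limit {0..M} (\<lambda>n. poly (p n)) f sequentially"
    using Weierstrass_poly[OF assms(2)] .
  note lim = cfc_LIMSEQ[OF assms(1) p]
  show "norm (cfc f T) \<le> d" if d: "\<And>x. x \<in> {0..M} \<Longrightarrow> \<bar>f x\<bar> \<le> d"
  proof (rule field_le_epsilon)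
    fix e :: real assume e: "e > 0"
    have "\<forall>\<^sub>F n in sequentially. norm (poly_op (p n) T) \<le> d + e"
      using uniform_limitD[OF p e]
    proof eventually_elim
      case (elim n)
      show ?case
      proof (rule norm_poly_op_le[OF assms(1)])
        fix x assume "x \<in> real_spectrum T"
        then have "x \<in> {0..M}" using spectrum_inD(2)[OF assms(1)] by blast
        then show "\<bar>poly (p n) x\<bar> \<le> d + e" using d[of x] bspec[OF elim, of x] by (simp add: dist_real_def)
      qed
    qed
    then show "norm (cfc f T) \<le> d + e"
      by (rule tendsto_upperbound[OF tendsto_norm[OF lim]]) simp
  qed
  show "\<bar>f r\<bar> \<le> norm (cfc f T)" if r: "r \<in> real_spectrum T"
  proof -
    have "r \<in> {0..M}" using spectrum_inD(2)[OF assms(1)] r by blast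
    then have "(\<lambda>n. poly (p n) r) \<longlonglongrightarrow> f r" using tendsto_uniform_limitI[OF p] by blast
    then have "(\<lambda>n. \<bar>poly (p n) r\<bar>) \<longlonglongrightarrow> \<bar>f r\<bar>" by (rule tendsto_rabs)
    then show ?thesis
      by (rule LIMSEQ_le[OF _ tendsto_norm[OF lim]])
         (use norm_poly_op_ge[OF spectrum_inD(1)[OF assms(1)] r] in auto)
  qed
qed

lemma tendsto_blinfun_apply_left:
  assumes "X \<longlonglongrightarrow> A"
  shows "(\<lambda>n. blinfun_apply (X n) x) \<longlonglongrightarrow> blinfun_apply A x"
  by (rule bounded_bilinear.tendsto[OF bounded_bilinear_blinfun_apply assms tendsto_const])

lemma closed_bounded_ops: "closed (bounded_ops :: ('h::complex_hilbert_space \<Rightarrow>\<^sub>L 'h) set)"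
  unfolding closed_sequential_limits
proof (intro allI impI, elim conjE)
  fix X and A :: "'h \<Rightarrow>\<^sub>L 'h" assume X: "\<forall>n. X n \<in> bounded_ops" and lim: "X \<longlonglongrightarrow> A"
  have "blinfun_apply A (c *\<^sub>C x) = c *\<^sub>C blinfun_apply A x" for c x
  proof (rule LIMSEQ_unique)
    show "(\<lambda>n. blinfun_apply (X n) (c *\<^sub>C x)) \<longlonglongrightarrow> blinfun_apply A (c *\<^sub>C x)"
      by (rule tendsto_blinfun_apply_left[OF lim])
    have "(\<lambda>n. c *\<^sub>C blinfun_apply (X n) x) \<longlonglongrightarrow> c *\<^sub>C blinfun_apply A x"
      by (rule bounded_linear.tendsto[OF bounded_linear_scaleC tendsto_blinfun_apply_left[OF lim]])
    then show "(\<lambda>n. blinfun_apply (X n) (c *\<^sub>C x)) \<longlonglongrightarrow> c *\<^sub>C blinfun_apply A x"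
      using X by (simp add: bounded_ops_def)
  qed
  then show "A \<in> bounded_ops" by (simp add: bounded_ops_def)
qed

lemma closed_symmetric_op: "closed {T :: 'h::complex_hilbert_space \<Rightarrow>\<^sub>L 'h. symmetric_op T}"
  unfolding closed_sequential_limits
proof (intro allI impI, elim conjE)
  fix X and A :: "'h \<Rightarrow>\<^sub>L 'h"
  assume X: "\<forall>n. X n \<in> {T. symmetric_op T}" and lim: "X \<longlonglongrightarrow> A"
  have "A \<in> bounded_ops"
    using closed_sequentially[OF closed_bounded_ops _ lim] X symmetric_opD(1) by blast
  moreover have "inner (blinfun_apply A x) y = inner x (blinfun_apply A y)" for x y
  proof (rule LIMSEQ_unique)
    show "(\<lambda>n. inner (blinfun_apply (X n) x) y) \<longlonglongrightarrow> inner (blinfun_apply A x) y"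
      by (intro tendsto_intros tendsto_blinfun_apply_left[OF lim])
    have "(\<lambda>n. inner x (blinfun_apply (X n) y)) \<longlonglongrightarrow> inner x (blinfun_apply A y)"
      by (intro tendsto_intros tendsto_blinfun_apply_left[OF lim])
    moreover have "inner x (blinfun_apply (X n) y) = inner (blinfun_apply (X n) x) y" for n
      using X symmetric_opD(2)[of "X n" x y] by simp
    ultimately show "(\<lambda>n. inner (blinfun_apply (X n) x) y) \<longlonglongrightarrow> inner x (blinfun_apply A y)"
      by simp
  qed
  ultimately show "A \<in> {T. symmetric_op T}" by (simp add: symmetric_op_def)
qed

lemma symmetric_cfc:
  assumes "spectrum_in T M" "continuous_on {0..M} f"
  shows "symmetric_op (cfc f T)"
  using cfc_in_closed[OF assms closed_symmetric_op] poly_op_symmetric[OF spectrum_inD(1)[OF assms(1)]]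
  by blast

text \<open>Writes f(T) as a square of a symmetric operator, the source of positivity for both the
  quadratic form and the trace.\<close>

lemma cfc_square_root:
  assumes "spectrum_in T M" "continuous_on {0..M} f" "\<And>x. x \<in> {0..M} \<Longrightarrow> 0 \<le> f x"
  shows "cfc f T = cfc (\<lambda>x. sqrt (f x)) T o\<^sub>L cfc (\<lambda>x. sqrt (f x)) T"
proof -
  have "cfc f T = cfc (\<lambda>x. sqrt (f x) * sqrt (f x)) T"
    by (rule cfc_cong) (use assms(3) spectrum_inD(2)[OF assms(1)] in auto)
  then show ?thesis using cfc_mult[OF assms(1), of "\<lambda>x. sqrt (f x)" "\<lambda>x. sqrt (f x)"] assms(2)
    by (simp add: continuous_on_real_sqrt)
qed

lemma cfc_nonneg:
  assumes "spectrum_in T M" "continuous_on {0..M} f" "\<And>x. x \<in> {0..M} \<Longrightarrow> 0 \<le> f x"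
  shows "0 \<le> inner (blinfun_apply (cfc f T) x) x"
proof -
  define R where "R = cfc (\<lambda>x. sqrt (f x)) T"
  have "symmetric_op R"
    unfolding R_def by (rule symmetric_cfc[OF assms(1) continuous_on_real_sqrt[OF assms(2)]])
  moreover have "cfc f T = R o\<^sub>L R" unfolding R_def by (rule cfc_square_root[OF assms])
  ultimately show ?thesis using symmetric_opD(2)[of R "blinfun_apply R x" x] by simp
qed

text \<open>Both f(T) and (K - f)(T) are positive, so the quadratic form of f(T) lies between 0 and
  K.\<close>

lemma spectrum_in_cfc:
  assumes "spectrum_in T M" "continuous_on {0..M} f" "f \<in> {0..M} \<rightarrow> {0..K}"
  shows "spectrum_in (cfc f T) K"
proof -
  have s: "symmetric_op (cfc f T)" by (rule symmetric_cfc[OF assms(1,2)])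
  have "cfc (\<lambda>x. K + (- 1) * f x) T = K *\<^sub>R id_blinfun + (- 1) *\<^sub>R cfc f T"
    by (subst cfc_add[OF assms(1)])
       (auto intro!: continuous_intros assms(2) simp: cfc_const[OF assms(1)] cfc_scaleR[OF assms(1,2), of "- 1", simplified])
  moreover have "0 \<le> inner (blinfun_apply (cfc (\<lambda>x. K + (- 1) * f x) T) x) x" for x
    by (rule cfc_nonneg[OF assms(1)]) (use assms(2,3) in \<open>auto intro!: continuous_intros\<close>)
  ultimately have "inner (blinfun_apply (cfc f T) x) x \<le> K * (norm x)\<^sup>2" for x
    by (simp add: blinfun.bilinear_simps inner_simps power2_norm_eq_inner)
  moreover have "0 * (norm x)\<^sup>2 \<le> inner (blinfun_apply (cfc f T) x) x" for x
    using cfc_nonneg[OF assms(1,2), of x] assms(3) by (auto simp: Pi_iff)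
  ultimately have "real_spectrum (cfc f T) \<subseteq> {0..K}"
    using real_spectrum_subset_Icc[OF symmetric_opD(1)[OF s]] by blast
  then show ?thesis using s spectrum_inD(3)[OF assms(1)] by (simp add: spectrum_in_def)
qed

lemma poly_op_cfc:
  assumes "spectrum_in T M" "continuous_on {0..M} f"
  shows "poly_op q (cfc f T) = cfc (\<lambda>x. poly q (f x)) T"
proof (induction q)
  case 0
  then show ?case using cfc_const[OF assms(1), of 0] by simp
next
  case (pCons a q)
  have "cfc (\<lambda>x. poly (pCons a q) (f x)) T = cfc (\<lambda>x. a + f x * poly q (f x)) T" by simp
  also have "\<dots> = a *\<^sub>R id_blinfun + (cfc f T o\<^sub>L cfc (\<lambda>x. poly q (f x)) T)"
    by (simp add: cfc_add[OF assms(1)] cfc_mult[OF assms(1)] cfc_const[OF assms(1)]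
        assms(2) continuous_on_mult continuous_on_poly)
  finally show ?case by (simp add: poly_op_pCons pCons)
qed

text \<open>Needed because \<open>Lp_norm\<close> nests two calculi, a power of
  \<open>abs_op\<close>, and because 4 - T is itself a function of T. Polynomials approximating g on
  {0..K} converge to both sides.\<close>

lemma cfc_compose:
  assumes T: "spectrum_in T M" and f: "continuous_on {0..M} f" "f \<in> {0..M} \<rightarrow> {0..K}"
    and g: "continuous_on {0..K} g"
  shows "cfc g (cfc f T) = cfc (\<lambda>x. g (f x)) T"
proof -
  obtain p where p: "uniform_limit {0..K} (\<lambda>n. poly (p n)) g sequentially"
    using Weierstrass_poly[OF g] .
  have gf: "continuous_on {0..M} (\<lambda>x. g (f x))"
    by (rule continuous_on_compose2[OF g f(1)]) (use f(2) in auto)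
  have pf: "continuous_on {0..M} (\<lambda>x. poly (p n) (f x))" for n
    by (intro continuous_on_poly f(1))
  have "(\<lambda>n. poly_op (p n) (cfc f T)) \<longlonglongrightarrow> cfc g (cfc f T)"
    by (rule cfc_LIMSEQ[OF spectrum_in_cfc[OF T f] p])
  moreover have "(\<lambda>n. poly_op (p n) (cfc f T)) \<longlonglongrightarrow> cfc (\<lambda>x. g (f x)) T"
  proof (rule tendstoI)
    fix e :: real assume e: "e > 0"
    have "\<forall>\<^sub>F n in sequentially. \<forall>x\<in>{0..K}. dist (poly (p n) x) (g x) < e / 2"
      using uniform_limitD[OF p, of "e / 2"] e by simp
    then show "\<forall>\<^sub>F n in sequentially. dist (poly_op (p n) (cfc f T)) (cfc (\<lambda>x. g (f x)) T) < e"
    proof eventually_elim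
      case (elim n)
      have "norm (cfc (\<lambda>x. poly (p n) (f x) + (- 1) * g (f x)) T) \<le> e / 2"
        by (rule cfc_norm_bounds(1)[OF T])
           (use elim f(2) in \<open>auto intro!: continuous_intros pf gf less_imp_le simp: dist_real_def Pi_iff\<close>)
      also have "cfc (\<lambda>x. poly (p n) (f x) + (- 1) * g (f x)) T
          = cfc (\<lambda>x. poly (p n) (f x)) T - cfc (\<lambda>x. g (f x)) T"
        using cfc_add[OF T pf[of n], of "\<lambda>x. (- 1) * g (f x)"] cfc_scaleR[OF T gf, of "- 1"] gf
        by (simp add: continuous_on_minus)
      finally show ?case using e by (simp add: poly_op_cfc[OF T f(1)] dist_norm)
    qed
  qed
  ultimately show ?thesis using LIMSEQ_unique by blast
qed

section \<open>The curve of powers\<close>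

text \<open>After raising to the power c this is (4 - s) y < s (4 - y), that is y < s. It fixes the
  sign of the derivatives below.\<close>

lemma powr_cross_less:
  fixes c s y :: real
  assumes "c > 0" "0 \<le> y" "y < s" "s \<le> 4"
  shows "(4 - s) powr c * y powr c < s powr c * (4 - y) powr c"
proof -
  have "((4 - s) * y) powr c < (s * (4 - y)) powr c"
  proof (rule powr_less_mono2)
    show "(4 - s) * y < s * (4 - y)" using assms by (simp add: algebra_simps)
    show "0 \<le> (4 - s) * y" using assms by (intro mult_nonneg_nonneg) auto
  qed (use assms in simp)
  then show ?thesis using assms by (simp add: powr_mult)
qed

text \<open>The weights are chosen to make the derivative of \<open>F\<close> vanish at s; it is
  negative before s and positive after.\<close>

lemma powr_sum_unique_minimum:
  fixes q s :: real
  assumes q: "q > 1" and s: "0 \<le> s" "s \<le> 4" and x: "0 \<le> x" "x \<le> 4" "x \<noteq> s"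
  defines "F \<equiv> \<lambda>x. (4 - s) powr (q - 1) * x powr q + s powr (q - 1) * (4 - x) powr q"
  shows "F s < F x"
proof -
  have cont: "continuous_on A F" if "A \<subseteq> {0..4}" for A
    unfolding F_def by (intro continuous_intros continuous_on_powr') (use that q in auto)
  have der: "(F has_real_derivative q * ((4 - s) powr (q - 1) * y powr (q - 1)
      - s powr (q - 1) * (4 - y) powr (q - 1))) (at y)" if "0 < y" "y < 4" for y
    unfolding F_def using that by (auto intro!: derivative_eq_intros simp: algebra_simps)
  show ?thesis
  proof (cases "x < s")
    case True
    show ?thesis
    proof (rule DERIV_neg_imp_decreasing_open[OF True _ cont])
      fix y assume y: "x < y" "y < s"
      have "(4 - s) powr (q - 1) * y powr (q - 1) < s powr (q - 1) * (4 - y) powr (q - 1)"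
        by (rule powr_cross_less) (use q s x y in auto)
      then show "\<exists>d. (F has_real_derivative d) (at y) \<and> d < 0"
        using der[of y] y s x q by (intro exI conjI) (auto simp: mult_less_0_iff)
    qed (use s x in auto)
  next
    case False
    then have less: "s < x" using x by simp
    show ?thesis
    proof (rule DERIV_pos_imp_increasing_open[OF less _ cont])
      fix y assume y: "s < y" "y < x"
      have "(4 - s) powr (q - 1) * y powr (q - 1) > s powr (q - 1) * (4 - y) powr (q - 1)"
        using powr_cross_less[of "q - 1" "4 - y" "4 - s"] q s x y by simp
      then show "\<exists>d. (F has_real_derivative d) (at y) \<and> d > 0"
        using der[of y] y s x q by (intro exI conjI) auto
    qed (use s x in auto)
  qed
qed

text \<open>For interior s the weights are those of the case q > 1 multiplied by (s (4 - s))^(1 -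
  q). The exponent 1 - q is positive, so they remain correct at s = 0 and s = 4, where
  \<open>powr\<close> with a negative exponent would return 0.\<close>

lemma powr_sum_unique_maximum:
  fixes q s :: real
  assumes q: "0 < q" "q < 1" and s: "0 \<le> s" "s \<le> 4" and x: "0 \<le> x" "x \<le> 4" "x \<noteq> s"
  defines "F \<equiv> \<lambda>x. s powr (1 - q) * x powr q + (4 - s) powr (1 - q) * (4 - x) powr q"
  shows "F x < F s"
proof -
  have cont: "continuous_on A F" if "A \<subseteq> {0..4}" for A
    unfolding F_def by (intro continuous_intros continuous_on_powr') (use that q in auto)
  have der: "(F has_real_derivative q * (s powr (1 - q) / y powr (1 - q)
      - (4 - s) powr (1 - q) / (4 - y) powr (1 - q))) (at y)" if "0 < y" "y < 4" for y
  proof -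
    have "y powr (q - 1) = 1 / y powr (1 - q)" "(4 - y) powr (q - 1) = 1 / (4 - y) powr (1 - q)"
      by (metis minus_diff_eq powr_minus_divide)+
    then show ?thesis
      unfolding F_def using that by (auto intro!: derivative_eq_intros simp: algebra_simps)
  qed
  show ?thesis
  proof (cases "x < s")
    case True
    show ?thesis
    proof (rule DERIV_pos_imp_increasing_open[OF True _ cont])
      fix y assume y: "x < y" "y < s"
      have "(4 - s) powr (1 - q) * y powr (1 - q) < s powr (1 - q) * (4 - y) powr (1 - q)"
        by (rule powr_cross_less) (use q s x y in auto)
      then have "(4 - s) powr (1 - q) / (4 - y) powr (1 - q) < s powr (1 - q) / y powr (1 - q)"
        using s x y by (simp add: pos_divide_less_eq pos_less_divide_eq mult.commute)
      then have "0 < q * (s powr (1 - q) / y powr (1 - q) - (4 - s) powr (1 - q) / (4 - y) powr (1 - q))"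
        using q by (intro mult_pos_pos) simp_all
      then show "\<exists>d. (F has_real_derivative d) (at y) \<and> d > 0"
        using der[of y] y s x by (intro exI conjI) simp_all
    qed (use s x in auto)
  next
    case False
    then have less: "s < x" using x by simp
    show ?thesis
    proof (rule DERIV_neg_imp_decreasing_open[OF less _ cont])
      fix y assume y: "s < y" "y < x"
      have "s powr (1 - q) * (4 - y) powr (1 - q) < (4 - s) powr (1 - q) * y powr (1 - q)"
        using powr_cross_less[of "1 - q" "4 - y" "4 - s"] q s x y by simp
      then have "(4 - s) powr (1 - q) / (4 - y) powr (1 - q) > s powr (1 - q) / y powr (1 - q)"
        using s x y by (simp add: pos_divide_less_eq pos_less_divide_eq mult.commute)
      then have "q * (s powr (1 - q) / y powr (1 - q) - (4 - s) powr (1 - q) / (4 - y) powr (1 - q)) < 0"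
        using q by (intro mult_pos_neg) simp_all
      then show "\<exists>d. (F has_real_derivative d) (at y) \<and> d < 0"
        using der[of y] y s x by (intro exI conjI) simp_all
    qed (use s x in auto)
  qed
qed

text \<open>The curve \<open>x \<mapsto> (x\<^sup>q, (4 - x)\<^sup>q)\<close> is strictly convex or strictly concave for \<open>q \<noteq> 1\<close>, so it has a
  supporting line at every point that meets it only there.\<close>

lemma powr_curve_supporting_line:
  fixes q s :: real
  assumes "0 < q" "q \<noteq> 1" "0 \<le> s" "s \<le> 4"
  obtains a b where "\<And>x. 0 \<le> x \<Longrightarrow> x \<le> 4 \<Longrightarrow> x \<noteq> s \<Longrightarrow>
    a * s powr q + b * (4 - s) powr q < a * x powr q + b * (4 - x) powr q"
proof (cases "q > 1")
  case True
  show ?thesis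
    by (rule that[of "(4 - s) powr (q - 1)" "s powr (q - 1)"])
       (use powr_sum_unique_minimum[OF True assms(3,4)] in auto)
next
  case False
  then have "q < 1" using assms by simp
  show ?thesis
    by (rule that[of "- (s powr (1 - q))" "- ((4 - s) powr (1 - q))"])
       (use powr_sum_unique_maximum[OF assms(1) \<open>q < 1\<close> assms(3,4)] in \<open>simp add: algebra_simps\<close>)
qed

text \<open>The chord between the end points of the curve has coordinate sum 4^q. Compare x^q = x
  x^(q-1) with x 4^(q-1), do the same for 4 - x, and add; the sign of \<open>a\<close> depends on
  whether q exceeds 1.\<close>

lemma powr_curve_chord:
  fixes q :: real
  assumes "0 < q" "q \<noteq> 1"
  obtains a where "\<And>x. 0 < x \<Longrightarrow> x < 4 \<Longrightarrow> 0 < a * (x powr q + (4 - x) powr q - 4 powr q)"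
proof -
  have e: "x powr q = x * x powr (q - 1)" if "0 < x" for x :: real
    using that by (simp add: powr_diff)
  have four: "4 powr q = x * 4 powr (q - 1) + (4 - x) * 4 powr (q - 1)" for x :: real
    by (simp add: e algebra_simps)
  show ?thesis
  proof (cases "q > 1")
    case True
    have *: "x powr q < x * 4 powr (q - 1)" if "0 < x" "x < 4" for x
      using that True by (simp add: e powr_less_mono2)
    show ?thesis
      by (rule that[of "- 1"]) (use *[of "x" for x] *[of "4 - x" for x] four in \<open>smt (verit)\<close>)
  next
    case False
    then have q: "q < 1" using assms by simp
    have *: "x powr q > x * 4 powr (q - 1)" if "0 < x" "x < 4" for x
      using that q by (simp add: e powr_less_mono2_neg)
    show ?thesis
      by (rule that[of 1]) (use *[of "x" for x] *[of "4 - x" for x] four in \<open>smt (verit)\<close>)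
  qed
qed

lemma continuous_on_powr_Icc:
  assumes "a > 0"
  shows "continuous_on {0..M::real} (\<lambda>x. x powr a)"
  by (intro continuous_intros continuous_on_powr') (use assms in auto)

lemma sqrt_powr: "0 \<le> s \<Longrightarrow> sqrt s powr p = s powr (p / 2)"
  by (simp add: powr_half_sqrt[symmetric] powr_powr)

lemma continuous_powr_combination:
  "q > 0 \<Longrightarrow> continuous_on {0..4} (\<lambda>x::real. a * x powr q + b * (4 - x) powr q + c)"
  by (intro continuous_intros continuous_on_powr') auto

section \<open>Distances between unitaries\<close>

text \<open>A von Neumann algebra is the commutant of its commutant, so this provides all its
  algebraic closure properties.\<close>

lemma commutant_intros:
  assumes "X \<subseteq> bounded_ops"
  shows "id_blinfun \<in> commutant X"
  "scalar_op c \<in> commutant X"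
  "A \<in> commutant X \<Longrightarrow> B \<in> commutant X \<Longrightarrow> A + B \<in> commutant X"
  "A \<in> commutant X \<Longrightarrow> B \<in> commutant X \<Longrightarrow> A - B \<in> commutant X"
  "A \<in> commutant X \<Longrightarrow> - A \<in> commutant X"
  "A \<in> commutant X \<Longrightarrow> r *\<^sub>R A \<in> commutant X"
  "A \<in> commutant X \<Longrightarrow> B \<in> commutant X \<Longrightarrow> A o\<^sub>L B \<in> commutant X"
proof -
  have *: "A \<in> commutant X \<longleftrightarrow> A \<in> bounded_ops \<and>
      (\<forall>C\<in>X. \<forall>x. blinfun_apply C (blinfun_apply A x) = blinfun_apply A (blinfun_apply C x))" for A
    by (auto simp: commutant_def blinfun_eq_iff)
  show "scalar_op c \<in> commutant X"
    using assms unfolding * by (auto simp: scalar_op_in_bounded_ops) (auto simp: bounded_ops_def)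
qed (auto simp: commutant_def bounded_ops_intros blinfun_eq_iff blinfun.bilinear_simps)

lemma closed_commutant: "closed (commutant X)"
  unfolding closed_sequential_limits
proof (intro allI impI, elim conjE)
  fix Y A assume Y: "\<forall>n. Y n \<in> commutant X" and lim: "Y \<longlonglongrightarrow> A"
  have "A \<in> bounded_ops"
    using closed_sequentially[OF closed_bounded_ops _ lim] Y by (auto simp: commutant_def)
  moreover have "B o\<^sub>L A = A o\<^sub>L B" if "B \<in> X" for B
  proof (rule LIMSEQ_unique)
    show "(\<lambda>n. B o\<^sub>L Y n) \<longlonglongrightarrow> (B o\<^sub>L A)"
      by (rule bounded_bilinear.tendsto[OF bounded_bilinear_blinfun_compose tendsto_const lim])
    have "(\<lambda>n. Y n o\<^sub>L B) \<longlonglongrightarrow> (A o\<^sub>L B)"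
      by (rule bounded_bilinear.tendsto[OF bounded_bilinear_blinfun_compose lim tendsto_const])
    then show "(\<lambda>n. B o\<^sub>L Y n) \<longlonglongrightarrow> (A o\<^sub>L B)" using Y that by (simp add: commutant_def)
  qed
  ultimately show "A \<in> commutant X" by (simp add: commutant_def)
qed

text \<open>Keeps Cayley transforms inside the algebra.\<close>

lemma commutant_inverse:
  assumes "A \<in> commutant X" "C \<in> bounded_ops" "C o\<^sub>L A = id_blinfun" "A o\<^sub>L C = id_blinfun"
  shows "C \<in> commutant X"
proof -
  have 1: "blinfun_apply C (blinfun_apply A x) = x" "blinfun_apply A (blinfun_apply C x) = x" for x
    using assms(3,4) by (simp_all add: blinfun_eq_iff)
  have "blinfun_apply B (blinfun_apply C x) = blinfun_apply C (blinfun_apply B x)" if "B \<in> X" for B x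
  proof -
    have "blinfun_apply A (blinfun_apply B (blinfun_apply C x)) = blinfun_apply B x"
    proof -
      have "B o\<^sub>L A = A o\<^sub>L B" using assms(1) that by (simp add: commutant_def)
      then have "blinfun_apply A (blinfun_apply B (blinfun_apply C x))
          = blinfun_apply B (blinfun_apply A (blinfun_apply C x))" by (simp add: blinfun_eq_iff)
      then show ?thesis by (simp add: 1)
    qed
    then show ?thesis using 1(1) by metis
  qed
  then show ?thesis using assms(2) by (auto simp: commutant_def blinfun_eq_iff)
qed

lemma inner_adj_op_compose:
  "A \<in> bounded_ops \<Longrightarrow> inner (blinfun_apply (adj_op A o\<^sub>L A) x) y = inner (blinfun_apply A x) (blinfun_apply A y)"
  by (metis blinfun_apply_blinfun_compose inner_adj_op inner_commute)

lemma adj_op_compose_eq_0D: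
  assumes "A \<in> bounded_ops" "adj_op A o\<^sub>L A = 0"
  shows "A = 0"
proof (rule blinfun_eqI)
  fix x
  have "inner (blinfun_apply A x) (blinfun_apply A x) = 0"
    using inner_adj_op_compose[OF assms(1), of x x] assms(2) by simp
  then show "blinfun_apply A x = blinfun_apply 0 x" by simp
qed

lemma adj_compose_symmetric:
  assumes "A \<in> bounded_ops" "adj_op A \<in> bounded_ops"
  shows "symmetric_op (adj_op A o\<^sub>L A)"
  unfolding symmetric_op_iff_adj
  using assms by (simp add: bounded_ops_intros adj_op_compose adj_op_adj_op)

locale tracial_algebra =
  fixes N :: "('h::complex_hilbert_space \<Rightarrow>\<^sub>L 'h) set" and \<tau> :: "('h \<Rightarrow>\<^sub>L 'h) \<Rightarrow> complex"
  assumes vN: "von_neumann_algebra N"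
    and nontrivial: "(id_blinfun :: 'h \<Rightarrow>\<^sub>L 'h) \<noteq> 0"
    and tr: "faithful_tracial_state N \<tau>"
begin

section \<open>Algebraic closure of N and positivity of the trace\<close>

lemma N_bounded: "A \<in> N \<Longrightarrow> A \<in> bounded_ops"
  using vN by (auto simp: von_neumann_algebra_def)

lemma N_adj: "A \<in> N \<Longrightarrow> adj_op A \<in> N"
  using vN by (auto simp: von_neumann_algebra_def)

lemma N_eq: "N = commutant (commutant N)"
  using vN by (simp add: von_neumann_algebra_def)

lemma N_intros:
  "id_blinfun \<in> N" "scalar_op c \<in> N"
  "A \<in> N \<Longrightarrow> B \<in> N \<Longrightarrow> A + B \<in> N" "A \<in> N \<Longrightarrow> B \<in> N \<Longrightarrow> A - B \<in> N"
  "A \<in> N \<Longrightarrow> - A \<in> N" "A \<in> N \<Longrightarrow> r *\<^sub>R A \<in> N" "A \<in> N \<Longrightarrow> B \<in> N \<Longrightarrow> A o\<^sub>L B \<in> N"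
proof -
  have "commutant N \<subseteq> bounded_ops" by (auto simp: commutant_def)
  note * = commutant_intros[OF this, folded N_eq]
  show "id_blinfun \<in> N" "scalar_op c \<in> N"
    "A \<in> N \<Longrightarrow> B \<in> N \<Longrightarrow> A + B \<in> N" "A \<in> N \<Longrightarrow> B \<in> N \<Longrightarrow> A - B \<in> N"
    "A \<in> N \<Longrightarrow> - A \<in> N" "A \<in> N \<Longrightarrow> r *\<^sub>R A \<in> N" "A \<in> N \<Longrightarrow> B \<in> N \<Longrightarrow> A o\<^sub>L B \<in> N"
    by (fact *)+
qed

lemma closed_N: "closed N"
  using closed_commutant[of "commutant N"] N_eq by simp

lemma N_inverse:
  "A \<in> N \<Longrightarrow> C \<in> bounded_ops \<Longrightarrow> C o\<^sub>L A = id_blinfun \<Longrightarrow> A o\<^sub>L C = id_blinfun \<Longrightarrow> C \<in> N"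
  using commutant_inverse[of A "commutant N" C] N_eq by simp

lemma poly_op_N: "T \<in> N \<Longrightarrow> poly_op q T \<in> N"
proof (induction q)
  case 0
  then show ?case using N_intros(6)[OF N_intros(1), of 0] by simp
qed (auto simp: poly_op_pCons N_intros)

lemma cfc_N:
  assumes "spectrum_in T M" "continuous_on {0..M} f" "T \<in> N"
  shows "cfc f T \<in> N"
  by (rule cfc_in_closed[OF assms(1,2) closed_N]) (rule poly_op_N[OF assms(3)])

lemma trace_add: "A \<in> N \<Longrightarrow> B \<in> N \<Longrightarrow> Re (\<tau> (A + B)) = Re (\<tau> A) + Re (\<tau> B)"
  using tr[unfolded faithful_tracial_state_def, THEN conjunct1] by simp

lemma trace_scaleR:
  assumes "A \<in> N"
  shows "Re (\<tau> (r *\<^sub>R A)) = r * Re (\<tau> A)"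
proof -
  have "r *\<^sub>R A = scalar_op (of_real r) o\<^sub>L A"
    by (simp add: blinfun_eq_iff blinfun.scaleR_left scaleC_of_real)
  moreover have "\<tau> (scalar_op (of_real r) o\<^sub>L A) = of_real r * \<tau> A"
    using tr[unfolded faithful_tracial_state_def, THEN conjunct2, THEN conjunct1] assms by blast
  ultimately show ?thesis by simp
qed

lemma trace_adj_compose:
  assumes "A \<in> N"
  shows "\<tau> (adj_op A o\<^sub>L A) \<in> \<real>" "0 \<le> Re (\<tau> (adj_op A o\<^sub>L A))"
    "\<tau> (adj_op A o\<^sub>L A) = 0 \<Longrightarrow> A = 0"
  using bspec[OF tr[unfolded faithful_tracial_state_def, THEN conjunct2, THEN conjunct2, THEN conjunct1] assms]
    bspec[OF tr[unfolded faithful_tracial_state_def, THEN conjunct2, THEN conjunct2, THEN conjunct2,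
      THEN conjunct2, THEN conjunct2] assms]
  by blast+

lemma trace_id: "Re (\<tau> id_blinfun) = 1"
  using tr[unfolded faithful_tracial_state_def, THEN conjunct2, THEN conjunct2, THEN conjunct2, THEN conjunct1]
  by simp

text \<open>With R the function sqrt f of T, f(T) is the adjoint of R times R. Positivity of the
  state gives the first claim; faithfulness gives R = 0 and so the second.\<close>

lemma trace_cfc_nonneg:
  assumes "spectrum_in T M" "continuous_on {0..M} f" "T \<in> N" "\<And>x. x \<in> {0..M} \<Longrightarrow> 0 \<le> f x"
  shows "0 \<le> Re (\<tau> (cfc f T))"
    and "Re (\<tau> (cfc f T)) = 0 \<Longrightarrow> r \<in> real_spectrum T \<Longrightarrow> f r = 0"
proof -
  define R where "R = cfc (\<lambda>x. sqrt (f x)) T"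
  have cR: "continuous_on {0..M} (\<lambda>x. sqrt (f x))" by (rule continuous_on_real_sqrt[OF assms(2)])
  have R: "R \<in> N" unfolding R_def by (rule cfc_N[OF assms(1) cR assms(3)])
  have "symmetric_op R" unfolding R_def by (rule symmetric_cfc[OF assms(1) cR])
  then have adj: "adj_op R = R" by (simp add: symmetric_op_iff_adj)
  have eq: "cfc f T = adj_op R o\<^sub>L R" unfolding adj unfolding R_def by (rule cfc_square_root[OF assms(1,2,4)])
  show "0 \<le> Re (\<tau> (cfc f T))" unfolding eq by (rule trace_adj_compose(2)[OF R])
  show "f r = 0" if z: "Re (\<tau> (cfc f T)) = 0" and r: "r \<in> real_spectrum T"
  proof -
    have "\<tau> (cfc f T) \<in> \<real>" unfolding eq by (rule trace_adj_compose(1)[OF R])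
    \<comment> \<open>The state is complex valued, so realness on such products is needed to pass
      from a zero real part to zero.\<close>
    then have "\<tau> (adj_op R o\<^sub>L R) = 0" using z unfolding eq by (auto simp: complex_is_Real_iff complex_eq_iff)
    then have "R = 0" by (rule trace_adj_compose(3)[OF R])
    then have "norm (cfc f T) = 0" by (simp add: eq)
    then show ?thesis using cfc_norm_bounds(2)[OF assms(1,2) r] by simp
  qed
qed

text \<open>The p-th power of the square root of \<open>adj_op A o\<^sub>L A\<close> is its power p
  / 2; this is the origin of the exponent q of the overview.\<close>

lemma Lp_norm_powr:
  assumes "A \<in> N" "spectrum_in (adj_op A o\<^sub>L A) M" "0 \<le> M" "p > 0"
  shows "Lp_norm \<tau> p A powr p = Re (\<tau> (cfc (\<lambda>x. x powr (p / 2)) (adj_op A o\<^sub>L A)))"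
proof -
  let ?T = "adj_op A o\<^sub>L A"
  have T: "?T \<in> N" using assms(1) by (intro N_intros N_adj)
  have "cfc (\<lambda>t. t powr p) (abs_op A) = cfc (\<lambda>x. sqrt x powr p) ?T"
    unfolding abs_op_def
    by (rule cfc_compose[OF assms(2), of sqrt "sqrt M"])
       (use assms in \<open>auto intro!: continuous_intros continuous_on_powr_Icc\<close>)
  also have "\<dots> = cfc (\<lambda>x. x powr (p / 2)) ?T"
  proof (rule cfc_cong)
    fix x assume "x \<in> real_spectrum ?T"
    then have "0 \<le> x" using spectrum_inD(2)[OF assms(2)] by auto
    then show "sqrt x powr p = x powr (p / 2)" by (simp add: powr_half_sqrt[symmetric] powr_powr)
  qed
  finally have eq: "cfc (\<lambda>t. t powr p) (abs_op A) = cfc (\<lambda>x. x powr (p / 2)) ?T" .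
  \<comment> \<open>Nonnegativity lets the outer exponents 1 / p and p cancel.\<close>
  have "0 \<le> Re (\<tau> (cfc (\<lambda>x. x powr (p / 2)) ?T))"
    by (rule trace_cfc_nonneg(1)[OF assms(2) _ T]) (use assms in \<open>auto intro: continuous_on_powr_Icc\<close>)
  then show ?thesis using assms(4) by (simp add: Lp_norm_def eq powr_powr)
qed

section \<open>Unitaries and the operator \<open>sqdist\<close>\<close>

lemma unitaryD:
  assumes "U \<in> unitary_group N"
  shows "U \<in> N" "adj_op U \<in> N" "U \<in> bounded_ops" "adj_op U \<in> bounded_ops"
    "blinfun_apply (adj_op U) (blinfun_apply U x) = x"
    "blinfun_apply U (blinfun_apply (adj_op U) x) = x"
    "norm (blinfun_apply U x) = norm x"
proof -
  show U: "U \<in> N" "adj_op U \<in> N" "U \<in> bounded_ops" "adj_op U \<in> bounded_ops"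
    using assms N_adj N_bounded by (auto simp: unitary_group_def)
  have "adj_op U o\<^sub>L U = id_blinfun" "U o\<^sub>L adj_op U = id_blinfun"
    using assms by (auto simp: unitary_group_def)
  then show *: "blinfun_apply (adj_op U) (blinfun_apply U x) = x"
    "blinfun_apply U (blinfun_apply (adj_op U) x) = x" for x
    by (simp_all add: blinfun_eq_iff)
  show "norm (blinfun_apply U x) = norm x"
    using inner_adj_op[OF U(3), of x "blinfun_apply U x"] by (simp add: norm_eq_sqrt_inner *)
qed

lemma unitary_id: "id_blinfun \<in> unitary_group N"
  by (simp add: unitary_group_def N_intros adj_op_id blinfun_eq_iff)

lemma unitary_minus: "U \<in> unitary_group N \<Longrightarrow> - U \<in> unitary_group N"
  using N_intros(5) adj_op_minus[OF N_bounded]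
  by (auto simp: unitary_group_def blinfun_eq_iff blinfun.bilinear_simps)

lemma unitary_scalar: "cmod c = 1 \<Longrightarrow> scalar_op c \<in> unitary_group N"
proof -
  assume "cmod c = 1"
  then have "c * cnj c = 1" by (simp add: complex_norm_square[symmetric])
  then show ?thesis
    by (simp add: unitary_group_def N_intros adj_op_scalar_op blinfun_eq_iff scaleC_scaleC mult.commute)
qed

abbreviation sqdist :: "('h \<Rightarrow>\<^sub>L 'h) \<Rightarrow> ('h \<Rightarrow>\<^sub>L 'h) \<Rightarrow> ('h \<Rightarrow>\<^sub>L 'h)" where
  "sqdist U V \<equiv> adj_op (U - V) o\<^sub>L (U - V)"

lemma sqdist_apply:
  assumes "U \<in> unitary_group N" "V \<in> unitary_group N"
  shows "blinfun_apply (sqdist U V) x = 2 *\<^sub>R x - blinfun_apply (adj_op U) (blinfun_apply V x)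
     - blinfun_apply (adj_op V) (blinfun_apply U x)"
  using unitaryD[OF assms(1)] unitaryD[OF assms(2)]
  by (simp add: adj_op_diff blinfun.bilinear_simps scaleR_2)

lemma sqdist_minus:
  assumes "U \<in> unitary_group N" "V \<in> unitary_group N"
  shows "sqdist U (- V) = 4 *\<^sub>R id_blinfun - sqdist U V"
proof (rule blinfun_eqI)
  fix x :: 'h
  have "4 *\<^sub>R x = 2 *\<^sub>R x + 2 *\<^sub>R x" using scaleR_add_left[of 2 2 x] by simp
  then show "blinfun_apply (sqdist U (- V)) x = blinfun_apply (4 *\<^sub>R id_blinfun - sqdist U V) x"
    unfolding blinfun.diff_left sqdist_apply[OF assms] sqdist_apply[OF assms(1) unitary_minus[OF assms(2)]]
    using unitaryD[OF assms(2)]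
    by (simp add: blinfun.bilinear_simps adj_op_minus)
qed

lemma sqdist_N:
  assumes "U \<in> unitary_group N" "V \<in> unitary_group N"
  shows "sqdist U V \<in> N" "U - V \<in> N"
  using unitaryD[OF assms(1)] unitaryD[OF assms(2)] by (auto intro!: N_intros N_adj)

lemma spectrum_in_sqdist:
  assumes "U \<in> unitary_group N" "V \<in> unitary_group N"
  shows "spectrum_in (sqdist U V) 4"
proof -
  have D: "U - V \<in> bounded_ops" "adj_op (U - V) \<in> bounded_ops"
    using sqdist_N[OF assms] N_adj N_bounded by blast+
  have s: "symmetric_op (sqdist U V)" by (rule adj_compose_symmetric[OF D])
  have "inner (blinfun_apply (sqdist U V) x) x = (norm (blinfun_apply (U - V) x))\<^sup>2" for x
    unfolding inner_adj_op_compose[OF D(1)] by (simp add: power2_norm_eq_inner)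
  moreover have "(norm (blinfun_apply (U - V) x))\<^sup>2 \<le> 4 * (norm x)\<^sup>2" for x
  proof -
    have "norm (blinfun_apply (U - V) x) \<le> 2 * norm x"
      using norm_triangle_ineq4[of "blinfun_apply U x" "blinfun_apply V x"]
        unitaryD(7)[OF assms(1)] unitaryD(7)[OF assms(2)] by (simp add: blinfun.diff_left)
    then show ?thesis using power_mono[of "norm (blinfun_apply (U - V) x)" "2 * norm x" 2]
      by (simp add: power_mult_distrib)
  qed
  ultimately have "real_spectrum (sqdist U V) \<subseteq> {0..4}"
    by (intro real_spectrum_subset_Icc symmetric_opD(1)[OF s]) auto
  then show ?thesis using s nontrivial by (simp add: spectrum_in_def)
qed

text \<open>An affine relation between the two distances becomes the trace of one function of one
  operator; the constant enters because the state maps the identity to 1.\<close>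

lemma Lp_norm_combination:
  assumes U: "U \<in> unitary_group N" and V: "V \<in> unitary_group N" and p: "p > 0"
  shows "a * Lp_norm \<tau> p (U - V) powr p + b * Lp_norm \<tau> p (U - (- V)) powr p + c
    = Re (\<tau> (cfc (\<lambda>x. a * x powr (p / 2) + b * (4 - x) powr (p / 2) + c) (sqdist U V)))"
proof -
  let ?T = "sqdist U V"
  note T = spectrum_in_sqdist[OF U V]
  note V' = unitary_minus[OF V]
  have c1: "continuous_on {0..4} (\<lambda>x::real. x powr (p / 2))"
    using p by (intro continuous_on_powr_Icc) simp
  have c2: "continuous_on {0..4} (\<lambda>x::real. (4 - x) powr (p / 2))"
    by (intro continuous_intros continuous_on_powr') (use p in auto)
  have c3: "continuous_on {0..4} (\<lambda>x::real. a * x powr (p / 2))"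
    "continuous_on {0..4} (\<lambda>x::real. b * (4 - x) powr (p / 2))"
    by (intro continuous_intros c1 c2)+
  have c4: "continuous_on {0..4} (\<lambda>x::real. a * x powr (p / 2) + b * (4 - x) powr (p / 2))"
    by (intro continuous_intros c3)
  have "sqdist U (- V) = poly_op [:4, - 1:] ?T"
    unfolding sqdist_minus[OF U V] by (simp add: poly_op_linear)
  also have "\<dots> = cfc (\<lambda>x. 4 - x) ?T"
    using cfc_poly[OF T, of "[:4, - 1:]"] cfc_cong[of ?T "poly [:4, - 1:]" "\<lambda>x. 4 - x"] by simp
  finally have "cfc (\<lambda>x. x powr (p / 2)) (sqdist U (- V)) = cfc (\<lambda>x. x powr (p / 2)) (cfc (\<lambda>x. 4 - x) ?T)"
    by (rule arg_cong)
  also have "\<dots> = cfc (\<lambda>x. (4 - x) powr (p / 2)) ?T"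
    by (rule cfc_compose[OF T _ _ c1]) (auto intro!: continuous_intros)
  finally have 2: "Lp_norm \<tau> p (U - (- V)) powr p = Re (\<tau> (cfc (\<lambda>x. (4 - x) powr (p / 2)) ?T))"
    using Lp_norm_powr[OF sqdist_N(2)[OF U V'] spectrum_in_sqdist[OF U V'] _ p]
    by (simp del: diff_minus_eq_add)
  have 1: "Lp_norm \<tau> p (U - V) powr p = Re (\<tau> (cfc (\<lambda>x. x powr (p / 2)) ?T))"
    using Lp_norm_powr[OF sqdist_N(2)[OF U V] T _ p] by simp
  note TN = sqdist_N(1)[OF U V]
  have "Re (\<tau> (cfc (\<lambda>x. a * x powr (p / 2) + b * (4 - x) powr (p / 2) + c) ?T))
     = Re (\<tau> (a *\<^sub>R cfc (\<lambda>x. x powr (p / 2)) ?T + b *\<^sub>R cfc (\<lambda>x. (4 - x) powr (p / 2)) ?T + c *\<^sub>R id_blinfun))"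
    unfolding cfc_add[OF T c4 continuous_on_const] cfc_add[OF T c3] cfc_scaleR[OF T c1] cfc_scaleR[OF T c2]
      cfc_const[OF T] ..
  also have "\<dots> = a * Re (\<tau> (cfc (\<lambda>x. x powr (p / 2)) ?T)) + b * Re (\<tau> (cfc (\<lambda>x. (4 - x) powr (p / 2)) ?T)) + c"
    using cfc_N[OF T c1 TN] cfc_N[OF T c2 TN] N_intros
    by (simp add: trace_add trace_scaleR trace_id)
  finally show ?thesis using 1 2 by simp
qed

text \<open>The common engine of all rigidity steps. The nonnegative function of zero trace vanishes
  on the spectrum, hence so does m, and the norm of m(T) is the maximum of |m| there.\<close>

lemma poly_op_sqdist_eq_0:
  assumes U: "U \<in> unitary_group N" and V: "V \<in> unitary_group N" and p: "p > 0"
    and nonneg: "\<And>x. 0 \<le> x \<Longrightarrow> x \<le> 4 \<Longrightarrow> 0 \<le> a * x powr (p / 2) + b * (4 - x) powr (p / 2) + c"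
    and eq: "a * Lp_norm \<tau> p (U - V) powr p + b * Lp_norm \<tau> p (U - (- V)) powr p + c = 0"
    and zero: "\<And>x. 0 \<le> x \<Longrightarrow> x \<le> 4 \<Longrightarrow> a * x powr (p / 2) + b * (4 - x) powr (p / 2) + c = 0 \<Longrightarrow> poly m x = 0"
  shows "poly_op m (sqdist U V) = 0"
proof -
  note T = spectrum_in_sqdist[OF U V]
  have "norm (poly_op m (sqdist U V)) \<le> 0"
  proof (rule norm_poly_op_le[OF T])
    fix x assume x: "x \<in> real_spectrum (sqdist U V)"
    then have "0 \<le> x" "x \<le> 4" using spectrum_inD(2)[OF T] by auto
    moreover have "a * x powr (p / 2) + b * (4 - x) powr (p / 2) + c = 0"
      by (rule trace_cfc_nonneg(2)[OF T continuous_powr_combination sqdist_N(1)[OF U V] _ _ x])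
         (use p nonneg eq Lp_norm_combination[OF U V p, of a b c] in auto)
    ultimately show "\<bar>poly m x\<bar> \<le> 0" using zero by simp
  qed
  then show ?thesis by simp
qed

text \<open>Since T - s is zero, s is the only possible spectral point, and the power function may
  be replaced by its value there.\<close>

lemma Lp_norm_eq_sqrt:
  assumes U: "U \<in> unitary_group N" and V: "V \<in> unitary_group N" and p: "p > 0"
    and s: "0 \<le> s" and eq: "sqdist U V = s *\<^sub>R id_blinfun"
  shows "Lp_norm \<tau> p (U - V) = sqrt s"
proof -
  note T = spectrum_in_sqdist[OF U V]
  have "poly_op [:- s, 1:] (sqdist U V) = 0" unfolding eq by (simp add: poly_op_linear)
  then have "r = s" if "r \<in> real_spectrum (sqdist U V)" for r
    using norm_poly_op_ge[OF spectrum_inD(1)[OF T] that, of "[:- s, 1:]"] by simp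
  then have "cfc (\<lambda>x. x powr (p / 2)) (sqdist U V) = cfc (\<lambda>_. s powr (p / 2)) (sqdist U V)"
    by (intro cfc_cong) simp
  then have "Lp_norm \<tau> p (U - V) powr p = s powr (p / 2)"
    using Lp_norm_powr[OF sqdist_N(2)[OF U V] T _ p] cfc_const[OF T, of "s powr (p / 2)"]
    by (simp add: trace_scaleR trace_id N_intros)
  then have "(Lp_norm \<tau> p (U - V) powr p) powr (1 / p) = (sqrt s powr p) powr (1 / p)"
    using s by (simp add: sqrt_powr)
  moreover have "0 \<le> Lp_norm \<tau> p (U - V)" by (simp add: Lp_norm_def)
  ultimately show ?thesis using p s by (simp add: powr_powr)
qed

text \<open>The trace averages the curve over the spectrum, and the average is the curve point at s.
  The supporting line there meets the curve only once, so the spectrum is {s}.\<close>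

lemma sqdist_eq_scalar:
  assumes U: "U \<in> unitary_group N" and V: "V \<in> unitary_group N" and p: "p > 0" "p \<noteq> 2"
    and s: "0 \<le> s" "s \<le> 4" and "Lp_norm \<tau> p (U - V) = sqrt s" "Lp_norm \<tau> p (U - (- V)) = sqrt (4 - s)"
  shows "sqdist U V = s *\<^sub>R id_blinfun"
proof -
  obtain a b where ab: "\<And>x. 0 \<le> x \<Longrightarrow> x \<le> 4 \<Longrightarrow> x \<noteq> s \<Longrightarrow>
      a * s powr (p / 2) + b * (4 - s) powr (p / 2) < a * x powr (p / 2) + b * (4 - x) powr (p / 2)"
    using powr_curve_supporting_line[of "p / 2" s] p s by auto
  \<comment> \<open>Shifts the supporting function so that its minimum, taken at s, is 0.\<close>
  define c where "c = - (a * s powr (p / 2) + b * (4 - s) powr (p / 2))"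
  have "poly_op [:- s, 1:] (sqdist U V) = 0"
  proof (rule poly_op_sqdist_eq_0[OF U V p(1), of a b c])
    show "0 \<le> a * x powr (p / 2) + b * (4 - x) powr (p / 2) + c" if "0 \<le> x" "x \<le> 4" for x
      using ab[OF that] by (cases "x = s") (auto simp: c_def)
    show "a * Lp_norm \<tau> p (U - V) powr p + b * Lp_norm \<tau> p (U - - V) powr p + c = 0"
      unfolding assms using s by (simp add: sqrt_powr c_def)
    show "poly [:- s, 1:] x = 0"
      if "0 \<le> x" "x \<le> 4" "a * x powr (p / 2) + b * (4 - x) powr (p / 2) + c = 0" for x
      using ab[OF that(1,2)] that(3) by (cases "x = s") (auto simp: c_def)
  qed
  then show ?thesis by (simp add: poly_op_linear)
qed

lemma Lp_norm_antipode: "U \<in> unitary_group N \<Longrightarrow> p > 0 \<Longrightarrow> Lp_norm \<tau> p (U - (- U)) = 2"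
proof -
  assume U: "U \<in> unitary_group N" and p: "p > 0"
  have "sqdist U (- U) = 4 *\<^sub>R id_blinfun" unfolding sqdist_minus[OF U U] by simp
  from Lp_norm_eq_sqrt[OF U unitary_minus[OF U] p _ this] show ?thesis by simp
qed

text \<open>One distance suffices at the extreme value, because x^q is largest on [0,4] only at 4;
  hence the weights -1, 0 and the constant 4^q.\<close>

lemma antipode_unique:
  assumes U: "U \<in> unitary_group N" and V: "V \<in> unitary_group N" and p: "p > 0"
    and d: "Lp_norm \<tau> p (U - V) = 2"
  shows "V = - U"
proof -
  have e: "2 powr p = 4 powr (p / 2)" using sqrt_powr[of 4 p] by simp
  have "poly_op [:- 4, 1:] (sqdist U V) = 0"
  proof (rule poly_op_sqdist_eq_0[OF U V p, of "- 1" 0 "4 powr (p / 2)"])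
    show "0 \<le> - 1 * x powr (p / 2) + 0 * (4 - x) powr (p / 2) + 4 powr (p / 2)" if "0 \<le> x" "x \<le> 4" for x
      using that p powr_mono2[of "p / 2" x 4] by simp
    show "- 1 * Lp_norm \<tau> p (U - V) powr p + 0 * Lp_norm \<tau> p (U - - V) powr p + 4 powr (p / 2) = 0"
      unfolding d e by simp
    show "poly [:- 4, 1:] x = 0"
      if "0 \<le> x" "x \<le> 4" "- 1 * x powr (p / 2) + 0 * (4 - x) powr (p / 2) + 4 powr (p / 2) = 0" for x
      using that p powr_less_mono2[of "p / 2" x 4] by (cases "x = 4") auto
  qed
  then have "sqdist U V = 4 *\<^sub>R id_blinfun" by (simp add: poly_op_linear)
  then have "sqdist U (- V) = 0" unfolding sqdist_minus[OF U V] by simp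
  moreover have "U - (- V) \<in> bounded_ops" using sqdist_N(2)[OF U unitary_minus[OF V]] N_bounded by blast
  ultimately have "U - (- V) = 0" by (rule adj_op_compose_eq_0D[rotated])
  then show ?thesis by (simp add: eq_neg_iff_add_eq_0 add.commute)
qed

text \<open>On a spectrum inside {0, 4} one of the two powers is 0 and the other 4^q.\<close>

lemma two_point_Lp_sum:
  assumes U: "U \<in> unitary_group N" and V: "V \<in> unitary_group N" and p: "p > 0"
    and eq: "poly_op [:0, 4, - 1:] (sqdist U V) = 0"
  shows "Lp_norm \<tau> p (U - V) powr p + Lp_norm \<tau> p (U - (- V)) powr p = 4 powr (p / 2)"
proof -
  note T = spectrum_in_sqdist[OF U V]
  have "1 * r powr (p / 2) + 1 * (4 - r) powr (p / 2) + 0 = 4 powr (p / 2)" if "r \<in> real_spectrum (sqdist U V)" for r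
  proof -
    have "r * (4 - r) = 0"
      using norm_poly_op_ge[OF spectrum_inD(1)[OF T] that, of "[:0, 4, - 1:]"] eq by simp
    then show ?thesis using p by auto
  qed
  then have "cfc (\<lambda>x. 1 * x powr (p / 2) + 1 * (4 - x) powr (p / 2) + 0) (sqdist U V)
      = cfc (\<lambda>_. 4 powr (p / 2)) (sqdist U V)"
    by (rule cfc_cong)
  then show ?thesis
    using Lp_norm_combination[OF U V p, of 1 1 0] cfc_const[OF T, of "4 powr (p / 2)"]
    by (simp add: trace_scaleR trace_id N_intros)
qed

text \<open>The curve leaves its chord strictly on one side between the end points, so an average on
  the chord can only come from the end points.\<close>

lemma Lp_sum_two_point:
  assumes U: "U \<in> unitary_group N" and V: "V \<in> unitary_group N" and p: "p > 0" "p \<noteq> 2"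
    and eq: "Lp_norm \<tau> p (U - V) powr p + Lp_norm \<tau> p (U - (- V)) powr p = 4 powr (p / 2)"
  shows "poly_op [:0, 4, - 1:] (sqdist U V) = 0"
proof -
  obtain a where a: "\<And>x. 0 < x \<Longrightarrow> x < 4 \<Longrightarrow> 0 < a * (x powr (p / 2) + (4 - x) powr (p / 2) - 4 powr (p / 2))"
    using powr_curve_chord[of "p / 2"] p by auto
  define c where "c = - a * 4 powr (p / 2)"
  have pos: "0 < a * x powr (p / 2) + a * (4 - x) powr (p / 2) + c" if "0 < x" "x < 4" for x
    using a[OF that] by (simp add: c_def algebra_simps)
  show ?thesis
  proof (rule poly_op_sqdist_eq_0[OF U V p(1), of a a c])
    show "0 \<le> a * x powr (p / 2) + a * (4 - x) powr (p / 2) + c" if "0 \<le> x" "x \<le> 4" for x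
      using pos[of x] that p by (cases "x = 0 \<or> x = 4") (auto simp: c_def)
    have "a * (Lp_norm \<tau> p (U - V) powr p + Lp_norm \<tau> p (U - (- V)) powr p) + c = 0"
      unfolding eq by (simp add: c_def)
    then show "a * Lp_norm \<tau> p (U - V) powr p + a * Lp_norm \<tau> p (U - - V) powr p + c = 0"
      by (simp add: distrib_left)
    show "poly [:0, 4, - 1:] x = 0"
      if "0 \<le> x" "x \<le> 4" "a * x powr (p / 2) + a * (4 - x) powr (p / 2) + c = 0" for x
      using pos[of x] that by (cases "x = 0 \<or> x = 4") auto
  qed
qed

section \<open>Skew-adjoint unitaries: commutation and centrality\<close>

lemma skew_unitary_sq:
  assumes "U \<in> unitary_group N" "adj_op U = - U"
  shows "blinfun_apply U (blinfun_apply U x) = - x"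
  using unitaryD(5)[OF assms(1), of x] assms(2) by (simp add: blinfun.minus_left minus_equation_iff)

text \<open>Here T = 2 + V W + W V, and V^2 = W^2 = -1 gives 4 T - T^2 = 2 - V W V W - W V W V. This
  is -K^2 for the commutator K, which is skew-adjoint, hence the adjoint of K times K.\<close>

lemma skew_unitaries_commute:
  assumes V: "V \<in> unitary_group N" "adj_op V = - V" and W: "W \<in> unitary_group N" "adj_op W = - W"
    and eq: "poly_op [:0, 4, - 1:] (sqdist V W) = 0"
  shows "V o\<^sub>L W = W o\<^sub>L V"
proof -
  note V2 = skew_unitary_sq[OF V] and W2 = skew_unitary_sq[OF W]
  let ?K = "(V o\<^sub>L W) - (W o\<^sub>L V)"
  have b: "V \<in> bounded_ops" "W \<in> bounded_ops" "V o\<^sub>L W \<in> bounded_ops" "W o\<^sub>L V \<in> bounded_ops"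
    using unitaryD(3)[OF V(1)] unitaryD(3)[OF W(1)] by (auto intro: bounded_ops_intros)
  have T: "blinfun_apply (sqdist V W) x = 2 *\<^sub>R x + blinfun_apply V (blinfun_apply W x)
     + blinfun_apply W (blinfun_apply V x)" for x
    using sqdist_apply[OF V(1) W(1), of x] by (simp add: V(2) W(2) blinfun.minus_left)
  have four: "4 *\<^sub>R x = x + x + x + x" for x :: 'h
    using scaleR_add_left[of 2 2 x] by (simp add: scaleR_2)
  have adjK: "adj_op ?K = - ?K"
    using b by (simp add: adj_op_diff adj_op_compose V(2) W(2) blinfun_eq_iff blinfun.bilinear_simps)
  have "adj_op ?K o\<^sub>L ?K = 0"
  proof (rule blinfun_eqI)
    fix x
    have "blinfun_apply (4 *\<^sub>R sqdist V W - (sqdist V W o\<^sub>L sqdist V W)) x = 0"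
      using eq unfolding poly_op_two_point by simp
    then have "4 *\<^sub>R blinfun_apply (sqdist V W) x
        - blinfun_apply (sqdist V W) (blinfun_apply (sqdist V W) x) = 0"
      by (simp only: blinfun.diff_left blinfun.scaleR_left blinfun_apply_blinfun_compose)
    then show "blinfun_apply (adj_op ?K o\<^sub>L ?K) x = blinfun_apply 0 x"
      unfolding T adjK by (simp add: blinfun.bilinear_simps four scaleR_2 V2 W2 algebra_simps)
  qed
  then have "?K = 0" using adj_op_compose_eq_0D[of ?K] b by (simp add: bounded_ops_intros)
  then show ?thesis by simp
qed

text \<open>By linearity skew-adjoint A suffice. For these the obstruction to commuting with V is
  the part of A that anticommutes with V, and it is shown to vanish by testing V against one unitary
  built from it.\<close>

lemma skew_unitary_central:
  assumes V: "V \<in> unitary_group N" "adj_op V = - V"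
    and comm: "\<And>W. W \<in> unitary_group N \<Longrightarrow> adj_op W = - W \<Longrightarrow> V o\<^sub>L W = W o\<^sub>L V"
  shows "V \<in> commutant N"
proof -
  note V2 = skew_unitary_sq[OF V]
  have bV: "V \<in> bounded_ops" "V \<in> N" using unitaryD[OF V(1)] by auto
  have skew: "blinfun_apply V (blinfun_apply A x) = blinfun_apply A (blinfun_apply V x)"
    if A: "A \<in> N" "adj_op A = - A" for A x
  proof -
    \<comment> \<open>As the inverse of V is -V, this is A minus its conjugate by V: twice the
      component of A that anticommutes with V.\<close>
    define S where "S = A + (V o\<^sub>L A o\<^sub>L V)"
    have SN: "S \<in> N" unfolding S_def by (intro N_intros A bV)
    note bA = N_bounded[OF A(1)] and bS = N_bounded[OF SN]
    have adjS: "adj_op S = - S"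
      unfolding S_def using bA bV
      by (simp add: adj_op_add adj_op_compose bounded_ops_intros A(2) V(2) blinfun_eq_iff blinfun.bilinear_simps)
    have SV: "blinfun_apply S (blinfun_apply V x) = - blinfun_apply V (blinfun_apply S x)" for x
      by (simp add: S_def blinfun.bilinear_simps V2)
    \<comment> \<open>The Cayley transform of the skew-adjoint S, composed with V, is again a skew-adjoint unitary
      because S and V anticommute.\<close>
    have BN: "id_blinfun - S \<in> N" "id_blinfun + S \<in> N" by (intro N_intros SN)+
    \<comment> \<open>A skew-adjoint S has zero real quadratic form, so 1 - S is coercive with
      constant 1.\<close>
    have "invertible_op (id_blinfun - S)"
    proof (rule coercive_invertible[OF N_bounded[OF BN(1)], of 1])
      fix x
      have "inner (blinfun_apply S x) x = - inner (blinfun_apply S x) x"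
        using inner_adj_op[OF bS, of x x] by (simp add: adjS blinfun.minus_left inner_commute)
      then show "1 * (norm x)\<^sup>2 \<le> inner (blinfun_apply (id_blinfun - S) x) x"
        by (simp add: blinfun.bilinear_simps inner_simps power2_norm_eq_inner)
    qed simp
    then obtain C where C: "C \<in> bounded_ops" "C o\<^sub>L (id_blinfun - S) = id_blinfun"
        "(id_blinfun - S) o\<^sub>L C = id_blinfun" by (auto simp: invertible_op_def)
    have CN: "C \<in> N" by (rule N_inverse[OF BN(1) C])
    define D where "D = adj_op C"
    have adjB: "adj_op (id_blinfun - S) = id_blinfun + S" "adj_op (id_blinfun + S) = id_blinfun - S"
      using bS by (simp_all add: adj_op_diff adj_op_add adj_op_id adjS bounded_ops_intros)
    have "(id_blinfun + S) o\<^sub>L D = id_blinfun" "D o\<^sub>L (id_blinfun + S) = id_blinfun"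
      using adj_op_compose[OF C(1) N_bounded[OF BN(1)]] adj_op_compose[OF N_bounded[OF BN(1)] C(1)]
      by (simp_all add: C adjB D_def adj_op_id)
    then have D: "blinfun_apply D x + blinfun_apply S (blinfun_apply D x) = x"
        "blinfun_apply D (x + blinfun_apply S x) = x" for x
      by (simp_all add: blinfun_eq_iff blinfun.bilinear_simps)
    have C': "blinfun_apply C x - blinfun_apply S (blinfun_apply C x) = x"
        "blinfun_apply C (x - blinfun_apply S x) = x" for x
      using C by (simp_all add: blinfun_eq_iff blinfun.bilinear_simps)
    \<comment> \<open>V exchanges 1 - S and 1 + S by anticommutation, hence also their inverses
      \<open>C\<close> and \<open>D\<close>.\<close>
    have CV: "blinfun_apply C (blinfun_apply V x) = blinfun_apply V (blinfun_apply D x)" for x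
    proof -
      have "blinfun_apply V (blinfun_apply D x) - blinfun_apply S (blinfun_apply V (blinfun_apply D x))
          = blinfun_apply V x"
        using arg_cong[OF D(1)[of x], of "blinfun_apply V"] by (simp add: SV blinfun.bilinear_simps)
      then show ?thesis using C'(2)[of "blinfun_apply V (blinfun_apply D x)"] by simp
    qed
    have CS: "blinfun_apply C (blinfun_apply S x) = blinfun_apply S (blinfun_apply C x)" for x
      using C'[of x] by (simp add: blinfun.bilinear_simps algebra_simps)
    define W where "W = (id_blinfun + S) o\<^sub>L (C o\<^sub>L V)"
    have W: "blinfun_apply W x = blinfun_apply V (blinfun_apply D x) + blinfun_apply S (blinfun_apply V (blinfun_apply D x))" for x
      by (simp add: W_def blinfun.bilinear_simps CV)
    have WN: "W \<in> N" unfolding W_def by (intro N_intros SN CN bV)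
    have "adj_op W = (adj_op V o\<^sub>L D) o\<^sub>L (id_blinfun - S)"
      unfolding W_def using N_bounded[OF BN(2)] C(1) bV(1)
      by (simp add: adj_op_compose bounded_ops_intros adjB D_def)
    also have "\<dots> = - W"
    proof (rule blinfun_eqI)
      fix x
      have "blinfun_apply ((adj_op V o\<^sub>L D) o\<^sub>L (id_blinfun - S)) x
          = - blinfun_apply C (blinfun_apply V (x - blinfun_apply S x))"
        by (simp add: V(2) CV blinfun.bilinear_simps)
      also have "blinfun_apply V (x - blinfun_apply S x) = blinfun_apply V x + blinfun_apply S (blinfun_apply V x)"
        by (simp add: SV blinfun.bilinear_simps)
      finally show "blinfun_apply ((adj_op V o\<^sub>L D) o\<^sub>L (id_blinfun - S)) x = blinfun_apply (- W) x"
        by (simp add: W_def blinfun.bilinear_simps CS)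
    qed
    finally have adjW: "adj_op W = - W" .
    have WW: "blinfun_apply W (blinfun_apply W x) = - x" for x
    proof -
      have "blinfun_apply D (blinfun_apply W x) = blinfun_apply D (blinfun_apply V (blinfun_apply D x)
          + blinfun_apply S (blinfun_apply V (blinfun_apply D x)))" by (simp only: W)
      also have "\<dots> = blinfun_apply V (blinfun_apply D x)" by (rule D(2))
      finally have "blinfun_apply W (blinfun_apply W x) = - (blinfun_apply D x + blinfun_apply S (blinfun_apply D x))"
        by (simp add: W[of "blinfun_apply W x"] V2 blinfun.bilinear_simps)
      then show ?thesis by (simp add: D(1))
    qed
    have "W \<in> unitary_group N"
      using WN by (simp add: unitary_group_def adjW blinfun_eq_iff blinfun.bilinear_simps WW)
    from comm[OF this adjW] have cW: "blinfun_apply V (blinfun_apply W x) = blinfun_apply W (blinfun_apply V x)" for x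
      by (simp add: blinfun_eq_iff)
    have S0: "blinfun_apply S y = 0" for y
    proof -
      \<comment> \<open>The choice x = (1 - S^2) y clears the inverses: \<open>C\<close> sends it to
        (1 + S) y and \<open>D\<close> to (1 - S) y. Commutation of V and W then reads (1 + S)^2 y =
        (1 - S)^2 y, so 4 S y = 0.\<close>
      define x where "x = y - blinfun_apply S (blinfun_apply S y)"
      have Dx: "blinfun_apply D x = y - blinfun_apply S y"
        using D(2)[of "y - blinfun_apply S y"] by (simp add: x_def blinfun.bilinear_simps)
      have Cx: "blinfun_apply C x = y + blinfun_apply S y"
        using C'(2)[of "y + blinfun_apply S y"] by (simp add: x_def blinfun.bilinear_simps)
      have "blinfun_apply W (blinfun_apply V x) = - (blinfun_apply C x + blinfun_apply S (blinfun_apply C x))"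
        by (simp add: W_def blinfun.bilinear_simps V2)
      moreover have "blinfun_apply V (blinfun_apply W x) = - (blinfun_apply D x - blinfun_apply S (blinfun_apply D x))"
        by (simp add: W blinfun.bilinear_simps V2 SV)
      ultimately have "blinfun_apply C x + blinfun_apply S (blinfun_apply C x)
          = blinfun_apply D x - blinfun_apply S (blinfun_apply D x)" using cW[of x] by (simp only: neg_equal_iff_equal)
      then have "4 *\<^sub>R blinfun_apply S y = 0"
        unfolding Cx Dx using scaleR_add_left[of 2 2 "blinfun_apply S y"]
        by (simp add: blinfun.bilinear_simps scaleR_2 algebra_simps)
      then show ?thesis by simp
    qed
    \<comment> \<open>V S equals V A - A V, so S = 0 is the desired commutation.\<close>
    have "blinfun_apply V (blinfun_apply S x) = 0" using S0 by simp
    then show ?thesis by (simp add: S_def blinfun.bilinear_simps V2)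
  qed
  have "blinfun_apply A (blinfun_apply V x) = blinfun_apply V (blinfun_apply A x)" if A: "A \<in> N" for A x
  proof -
    \<comment> \<open>Both parts are skew-adjoint and 2 A = A1 - i A2.\<close>
    define A1 A2 where "A1 = A - adj_op A" and "A2 = scalar_op \<i> o\<^sub>L (A + adj_op A)"
    have b: "A \<in> bounded_ops" "adj_op A \<in> bounded_ops" "A + adj_op A \<in> bounded_ops"
      using N_bounded[OF A] N_bounded[OF N_adj[OF A]] by (auto intro: bounded_ops_intros)
    have "A1 \<in> N" "A2 \<in> N" unfolding A1_def A2_def by (intro N_intros A N_adj)+
    moreover have "adj_op A1 = - A1" using b by (simp add: A1_def adj_op_diff adj_op_adj_op)
    moreover have "adj_op A2 = - A2"
      using b by (simp add: A2_def adj_op_compose scalar_op_in_bounded_ops adj_op_scalar_op adj_op_add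
          adj_op_adj_op blinfun_eq_iff blinfun.bilinear_simps)
        (simp add: bounded_ops_def scaleC_linear scaleC_minus_left blinfun.minus_right algebra_simps)
    ultimately have c: "blinfun_apply V (blinfun_apply A1 y) = blinfun_apply A1 (blinfun_apply V y)"
      "blinfun_apply V (blinfun_apply A2 y) = blinfun_apply A2 (blinfun_apply V y)" for y
      using skew by blast+
    have e: "2 *\<^sub>R blinfun_apply A y = blinfun_apply A1 y + (- \<i>) *\<^sub>C blinfun_apply A2 y" for y
      by (simp add: A1_def A2_def blinfun.bilinear_simps scaleC_add_right scaleC_scaleC scaleR_2)
    have "2 *\<^sub>R blinfun_apply V (blinfun_apply A x)
        = blinfun_apply V (blinfun_apply A1 x + (- \<i>) *\<^sub>C blinfun_apply A2 x)"
      using arg_cong[OF e[of x], of "blinfun_apply V"] by (simp only: blinfun.scaleR_right)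
    also have "\<dots> = blinfun_apply A1 (blinfun_apply V x) + (- \<i>) *\<^sub>C blinfun_apply A2 (blinfun_apply V x)"
      using bV(1) by (simp add: blinfun.add_right bounded_ops_def c)
    also have "\<dots> = 2 *\<^sub>R blinfun_apply A (blinfun_apply V x)" by (rule e[symmetric])
    finally show ?thesis by simp
  qed
  then show ?thesis using bV by (auto simp: commutant_def blinfun_eq_iff)
qed

lemma sqdist_scalar_op:
  "sqdist (scalar_op a) (scalar_op b) = (cmod (a - b))\<^sup>2 *\<^sub>R id_blinfun"
proof -
  have d: "scalar_op a - scalar_op b = (scalar_op (a - b) :: 'h \<Rightarrow>\<^sub>L 'h)"
    using scaleC_add_left[of "a - b" b "_ :: 'h"] by (simp add: blinfun_eq_iff blinfun.diff_left diff_eq_eq)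
  have n: "cnj (a - b) * (a - b) = complex_of_real ((cmod (a - b))\<^sup>2)"
    by (subst mult.commute) (rule complex_norm_square[symmetric])
  show ?thesis
    unfolding d adj_op_scalar_op blinfun_eq_iff blinfun_apply_blinfun_compose scalar_op_apply
      scaleC_scaleC n scaleC_of_real by (simp add: blinfun.scaleR_left)
qed

text \<open>The operator is 2 - U - \<open>adj_op U\<close>; so skew-adjointness is a condition of
  the kind that the isometry preserves.\<close>

lemma skew_iff_sqdist_id:
  assumes U: "U \<in> unitary_group N"
  shows "adj_op U = - U \<longleftrightarrow> sqdist U id_blinfun = 2 *\<^sub>R id_blinfun"
proof -
  note I = unitary_id
  have "blinfun_apply (sqdist U id_blinfun) x = blinfun_apply (2 *\<^sub>R id_blinfun) x \<longleftrightarrow>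
      blinfun_apply (adj_op U) x = blinfun_apply (- U) x" for x
    unfolding sqdist_apply[OF U I]
    by (auto simp: adj_op_id blinfun.bilinear_simps algebra_simps eq_neg_iff_add_eq_0)
  then show ?thesis unfolding blinfun_eq_iff by blast
qed

end

section \<open>The action of the isometry on scalar unitaries\<close>

theorem lemma2p6:
  fixes p :: real
    and N :: "('h::complex_hilbert_space \<Rightarrow>\<^sub>L 'h) set"
    and \<tau> :: "('h \<Rightarrow>\<^sub>L 'h) \<Rightarrow> complex"
    and \<psi> :: "('h \<Rightarrow>\<^sub>L 'h) \<Rightarrow> ('h \<Rightarrow>\<^sub>L 'h)"
  assumes "0 < p" and "p \<noteq> 2"
    and "type_II1_factor N"
    and "faithful_tracial_state N \<tau>"
    and "Lp_isometry N \<tau> p \<psi>"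
    and "\<psi> ` unitary_group N = unitary_group N"
    and "\<psi> id_blinfun = id_blinfun"
  shows "(\<forall>\<theta>::real. \<psi> (scalar_op (exp (\<i> * of_real \<theta>))) = scalar_op (exp (\<i> * of_real \<theta>))) \<or>
         (\<forall>\<theta>::real. \<psi> (scalar_op (exp (\<i> * of_real \<theta>))) = scalar_op (exp (- (\<i> * of_real \<theta>))))"
proof -
  have fac: "factor N" using assms(3) by (simp add: type_II1_factor_def)
  interpret tracial_algebra N \<tau>
    using fac assms(4) by unfold_locales (auto simp: factor_def)
  let ?U = "unitary_group N"
  note p = assms(1,2)
  have map: "\<psi> U \<in> ?U" if "U \<in> ?U" for U
    using assms(6) that by blast
  have iso: "Lp_norm \<tau> p (\<psi> U - \<psi> V) = Lp_norm \<tau> p (U - V)" if "U \<in> ?U" "V \<in> ?U" for U V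
    using assms(5) that by (simp add: Lp_isometry_def)
  have anti: "\<psi> (- U) = - \<psi> U" if "U \<in> ?U" for U
    using antipode_unique[OF map[OF that] map[OF unitary_minus[OF that]] p(1)]
      iso[OF that unitary_minus[OF that]] Lp_norm_antipode[OF that p(1)] by simp
  have iso': "Lp_norm \<tau> p (\<psi> U - (- \<psi> V)) = Lp_norm \<tau> p (U - (- V))" if "U \<in> ?U" "V \<in> ?U" for U V
    using iso[OF that(1) unitary_minus[OF that(2)]] anti[OF that(2)] by simp
  have sq: "sqdist (\<psi> U) (\<psi> V) = s *\<^sub>R id_blinfun \<longleftrightarrow> sqdist U V = s *\<^sub>R id_blinfun"
    if UV: "U \<in> ?U" "V \<in> ?U" and s: "0 \<le> s" "s \<le> 4" for U V s
  proof -
    \<comment> \<open>The right-hand side involves only quantities fixed by \<open>iso\<close> and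
      \<open>iso'\<close>; the equivalence is stated for arbitrary unitaries in order to be used
      before and after applying \<open>\<psi>\<close>.\<close>
    have *: "sqdist U V = s *\<^sub>R id_blinfun \<longleftrightarrow>
        Lp_norm \<tau> p (U - V) = sqrt s \<and> Lp_norm \<tau> p (U - (- V)) = sqrt (4 - s)"
      if UV: "U \<in> ?U" "V \<in> ?U" for U V
    proof
      assume eq: "sqdist U V = s *\<^sub>R id_blinfun"
      have "sqdist U (- V) = (4 - s) *\<^sub>R id_blinfun"
        unfolding sqdist_minus[OF UV] eq by (simp add: scaleR_diff_left)
      then show "Lp_norm \<tau> p (U - V) = sqrt s \<and> Lp_norm \<tau> p (U - (- V)) = sqrt (4 - s)"
        using Lp_norm_eq_sqrt[OF UV p(1) s(1) eq]
          Lp_norm_eq_sqrt[OF UV(1) unitary_minus[OF UV(2)] p(1), of "4 - s"] s by simp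
    qed (use sqdist_eq_scalar[OF UV p s] in blast)
    show ?thesis
      unfolding *[OF UV] *[OF map[OF UV(1)] map[OF UV(2)]] iso[OF UV] iso'[OF UV] ..
  qed
  note I = unitary_id
  have skew: "adj_op (\<psi> U) = - \<psi> U \<longleftrightarrow> adj_op U = - U" if "U \<in> ?U" for U
    using sq[OF that I, of 2] assms(7) skew_iff_sqdist_id[OF that] skew_iff_sqdist_id[OF map[OF that]]
    by simp
  define J where "J = (scalar_op \<i> :: 'h \<Rightarrow>\<^sub>L 'h)"
  have J: "J \<in> ?U" "adj_op J = - J"
    by (auto simp: J_def unitary_scalar adj_op_scalar_op blinfun_eq_iff scaleC_minus_left blinfun.minus_left)
  have Ja: "blinfun_apply J x = \<i> *\<^sub>C x" for x by (simp add: J_def)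
  define V where "V = \<psi> J"
  have V: "V \<in> ?U" "adj_op V = - V" using map[OF J(1)] skew[OF J(1)] J(2) by (auto simp: V_def)
  have "V \<in> commutant N"
  proof (rule skew_unitary_central[OF V])
    fix W assume W: "W \<in> ?U" "adj_op W = - W"
    \<comment> \<open>Surjectivity reaches every skew-adjoint unitary, and \<open>skew\<close> read
      backwards makes its preimage skew-adjoint.\<close>
    then obtain U where U: "U \<in> ?U" "W = \<psi> U" using assms(6) by blast
    then have sU: "adj_op U = - U" using skew W by blast
    \<comment> \<open>H = i U satisfies H^2 = 1, and T = 2 (1 + H), so T^2 = 4 T. The vector
      \<open>u\<close> below is H x.\<close>
    have "poly_op [:0, 4, - 1:] (sqdist J U) = 0"
    proof (rule blinfun_eqI)
      fix x
      have T: "blinfun_apply (sqdist J U) y = 2 *\<^sub>R y + 2 *\<^sub>R (\<i> *\<^sub>C blinfun_apply U y)" for y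
        unfolding sqdist_apply[OF J(1) U(1)] using unitaryD(3)[OF U(1)]
        by (simp add: J(2) sU Ja blinfun.minus_left bounded_ops_def scaleR_2)
      define u where "u = \<i> *\<^sub>C blinfun_apply U x"
      have "\<i> *\<^sub>C blinfun_apply U u = x"
        using unitaryD(3)[OF U(1)] unfolding u_def
        by (simp add: bounded_ops_def scaleC_scaleC skew_unitary_sq[OF U(1) sU] scaleC_minus_left)
      then have u: "blinfun_apply (sqdist J U) u = blinfun_apply (sqdist J U) x"
        unfolding T by (simp add: u_def add.commute)
      have "blinfun_apply (sqdist J U) (blinfun_apply (sqdist J U) x)
          = 2 *\<^sub>R blinfun_apply (sqdist J U) x + 2 *\<^sub>R blinfun_apply (sqdist J U) u"
        using arg_cong[OF T[of x, folded u_def], of "blinfun_apply (sqdist J U)"]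
        by (simp only: blinfun.add_right blinfun.scaleR_right)
      then have "blinfun_apply (sqdist J U) (blinfun_apply (sqdist J U) x) = 4 *\<^sub>R blinfun_apply (sqdist J U) x"
        unfolding u using scaleR_add_left[of 2 2 "blinfun_apply (sqdist J U) x"] by simp
      then show "blinfun_apply (poly_op [:0, 4, - 1:] (sqdist J U)) x = blinfun_apply 0 x"
        unfolding poly_op_two_point blinfun.diff_left blinfun.scaleR_left
        by (simp only: blinfun_apply_blinfun_compose) simp
    qed
    then have "Lp_norm \<tau> p (V - W) powr p + Lp_norm \<tau> p (V - (- W)) powr p = 4 powr (p / 2)"
      using two_point_Lp_sum[OF J(1) U(1) p(1)] unfolding V_def U(2) iso[OF J(1) U(1)] iso'[OF J(1) U(1)]
      by blast
    then show "V o\<^sub>L W = W o\<^sub>L V"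
      by (intro skew_unitaries_commute[OF V W] Lp_sum_two_point[OF V(1) W(1) p])
  qed
  \<comment> \<open>A central element of a factor is a scalar.\<close>
  then obtain c where c: "V = scalar_op c"
    using fac unitaryD(1)[OF V(1)] unfolding factor_def by blast
  obtain x0 :: 'h where "x0 \<noteq> 0"
    using nontrivial by (auto simp: blinfun_eq_iff)
  have "(c * c + 1) *\<^sub>C x0 = 0"
    using skew_unitary_sq[OF V, of x0] by (simp add: c scaleC_scaleC scaleC_add_left)
  then have "cmod (c * c + 1) * norm x0 = 0" by (metis norm_scaleC norm_zero)
  then have cc: "c * c = - 1" using \<open>x0 \<noteq> 0\<close> by (simp add: eq_neg_iff_add_eq_0)
  \<comment> \<open>Keeping c undetermined, subject to c^2 = -1, treats both alternatives at once:
    the distances from I and from V = c I determine the sum and the difference of W and its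
    adjoint.\<close>
  have key: "\<psi> (scalar_op (exp (\<i> * of_real \<theta>))) = scalar_op (of_real (cos \<theta>) + c * of_real (sin \<theta>))" for \<theta>
  proof -
    define e where "e = exp (\<i> * complex_of_real \<theta>)"
    have e: "e = Complex (cos \<theta>) (sin \<theta>)" by (simp add: e_def exp_Euler complex_eq_iff cos_of_real sin_of_real)
    have E: "scalar_op e \<in> ?U" by (rule unitary_scalar) (simp add: e_def)
    define W where "W = \<psi> (scalar_op e)"
    have W: "W \<in> ?U" unfolding W_def by (rule map[OF E])
    have s1: "(cmod (e - 1))\<^sup>2 = 2 - 2 * cos \<theta>" and s2: "(cmod (e - \<i>))\<^sup>2 = 2 - 2 * sin \<theta>"
      using sin_cos_squared_add[of \<theta>] unfolding e cmod_power2
      by (simp_all add: power2_eq_square algebra_simps)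
    have b: "0 \<le> 2 - 2 * cos \<theta>" "2 - 2 * cos \<theta> \<le> 4" "0 \<le> 2 - 2 * sin \<theta>" "2 - 2 * sin \<theta> \<le> 4"
      using cos_ge_minus_one[of \<theta>] cos_le_one[of \<theta>] sin_ge_minus_one[of \<theta>] sin_le_one[of \<theta>] by linarith+
    have "scalar_op 1 = (id_blinfun :: 'h \<Rightarrow>\<^sub>L 'h)" by (simp add: blinfun_eq_iff)
    then have "sqdist (scalar_op e) id_blinfun = (2 - 2 * cos \<theta>) *\<^sub>R id_blinfun"
      using sqdist_scalar_op[of e 1] s1 by simp
    then have q1: "sqdist W id_blinfun = (2 - 2 * cos \<theta>) *\<^sub>R id_blinfun"
      unfolding W_def using sq[OF E I b(1,2)] assms(7) by simp
    have 1: "blinfun_apply W x + blinfun_apply (adj_op W) x = (2 * cos \<theta>) *\<^sub>R x" for x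
      using sqdist_apply[OF W I, of x, unfolded q1]
      by (simp add: adj_op_id blinfun.scaleR_left blinfun.diff_left scaleR_diff_left algebra_simps)
    have q2: "sqdist W V = (2 - 2 * sin \<theta>) *\<^sub>R id_blinfun"
      unfolding W_def V_def using sq[OF E J(1) b(3,4)] sqdist_scalar_op[of e \<i>] s2
      by (simp add: J_def)
    have "blinfun_apply (adj_op W) (c *\<^sub>C x) - c *\<^sub>C blinfun_apply W x = (2 * sin \<theta>) *\<^sub>R x" for x
      using sqdist_apply[OF W V(1), of x, unfolded q2 V(2)]
      by (simp add: c blinfun.scaleR_left blinfun.diff_left blinfun.minus_left scaleR_diff_left algebra_simps)
    then have 2: "c *\<^sub>C blinfun_apply (adj_op W) x - c *\<^sub>C blinfun_apply W x = (2 * sin \<theta>) *\<^sub>R x" for x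
      using unitaryD(4)[OF W] by (simp add: bounded_ops_def)
    have "2 *\<^sub>R blinfun_apply W x = 2 *\<^sub>R ((of_real (cos \<theta>) + c * of_real (sin \<theta>)) *\<^sub>C x)" for x
    proof -
      \<comment> \<open>Multiplying by c and using c^2 = -1 isolates W minus its adjoint; adding
        \<open>1\<close> gives 2 W.\<close>
      have "c *\<^sub>C (c *\<^sub>C blinfun_apply (adj_op W) x - c *\<^sub>C blinfun_apply W x) = c *\<^sub>C ((2 * sin \<theta>) *\<^sub>R x)"
        unfolding 2 ..
      then have d: "blinfun_apply W x - blinfun_apply (adj_op W) x = (2 * sin \<theta>) *\<^sub>R (c *\<^sub>C x)"
        by (simp add: scaleC_linear scaleC_scaleC cc scaleC_minus_left)
      have "2 *\<^sub>R blinfun_apply W x = (blinfun_apply W x + blinfun_apply (adj_op W) x)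
          + (blinfun_apply W x - blinfun_apply (adj_op W) x)" by (simp add: scaleR_2)
      also have "\<dots> = 2 *\<^sub>R (cos \<theta> *\<^sub>R x + sin \<theta> *\<^sub>R (c *\<^sub>C x))"
        unfolding 1 d by (simp add: scaleR_add_right)
      also have "cos \<theta> *\<^sub>R x + sin \<theta> *\<^sub>R (c *\<^sub>C x) = (of_real (cos \<theta>) + c * of_real (sin \<theta>)) *\<^sub>C x"
        by (simp add: scaleC_add_left scaleC_of_real[symmetric] scaleC_scaleC mult.commute)
      finally show ?thesis .
    qed
    then have "W = scalar_op (of_real (cos \<theta>) + c * of_real (sin \<theta>))" by (simp add: blinfun_eq_iff)
    then show ?thesis by (simp add: W_def e_def)
  qed
  have "(c - \<i>) * (c + \<i>) = 0" using cc by (simp add: algebra_simps)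
  then consider "c = \<i>" | "c = - \<i>" by (auto simp: eq_neg_iff_add_eq_0)
  then show ?thesis
  proof cases
    case 1
    then show ?thesis using key by (simp add: exp_Euler cos_of_real sin_of_real)
  next
    case 2
    have "exp (- (\<i> * of_real \<theta>)) = of_real (cos \<theta>) + c * of_real (sin \<theta>)" for \<theta> :: real
      using exp_Euler[of "- of_real \<theta>"] by (simp add: 2 cos_of_real sin_of_real)
    then show ?thesis using key by simp
  qed
qed

end
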